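(* Assume that Conjecture F, Conjecture I and Conjecture Z (stated in the context) hold. Let $\xi\in\mathbb C$ be a zero of some non-zero $E$-function. Then exactly one of the following holds: (a) $\xi\neq0$, there exists $\beta\in\overline{\mathbb Q}^*$ with $e^{\beta\xi}\in\overline{\mathbb Q}$, and for every $E$-function $f$ with $f(\xi)=0$ there exists an integer $N\ge1$ such that $e^{\beta x/N}-e^{\beta\xi/N}$ divides $f$ in $\mathcal E$; (b) there exists an irreducible $E$-function $h$ with $h(\xi)=0$, and $h$ divides in $\mathcal E$ every $E$-function that vanishes at $\xi$.
   Context: $\overline{\mathbb Q}$ is embedded in $\mathbb C$. A power series $f(x)=\sum_{n\ge0}a_n x^n/n!\in\overline{\mathbb Q}[[x]]$ is an $E$-function if: (i) $f$ satisfies a non-zero linear differential equation with coefficients in $\overline{\mathbb Q}(x)$; (ii) there is $C_1>0$ such that all Galois conjugates of $a_n$ have modulus $\le C_1^{n+1}$ for all $n\ge0$; (iii) there are $C_2>0$ and positive integers $d_n\le C_2^{n+1}$ such that $d_na_m$ is an algebraic integer for all $m\le n$. $E$-functions form a ring $\mathcal E$ whose units are the functions $\lambda e^{\alpha x}$, $\lambda,\alpha\in\overline{\mathbb Q}$, $\lambda\ne0$; $g$ divides $f$ means $f=gg_1$ with $g_1\in\mathcal E$. An irreducible $E$-function is a non-unit $f$ such that $f=gh$ with $g,h\in\mathcal E$ implies $g$ or $h$ is a unit. A simple $E$-function is one of the form $g(x)=x^{-\omega}e^{\alpha x}\sum_{i=1}^N\lambda_ie^{\beta r_ix}$ with $\alpha,\beta\in\overline{\mathbb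 Q}$, $\beta\ne0$, $N\ge2$, $\lambda_i\in\overline{\mathbb Q}^*$, pairwise distinct $r_i\in\mathbb Q$, and the integer $\omega$ chosen so that $g$ is holomorphic at $0$ with $g(0)\ne0$; its support is $\mathrm{Span}_{\mathbb Q}(\beta)$. A non-zero $f\in\mathcal E$ with Taylor expansion $\sum_n a_nx^n$ at $0$ is normalized if for some $p\ge0$, $a_0=\dots=a_{p-1}=0$, $a_p=1$, $a_{p+1}=0$. Conjecture F: every non-zero $E$-function $f$ can be written as $f=us_1\cdots s_ph_1\cdots h_n$ ($p,n\ge0$) with $u$ a unit, $s_1,\dots,s_p$ simple normalized $E$-functions with pairwise distinct supports, and $h_1,\dots,h_n$ irreducible normalized $E$-functions, and these are unique (the $s_i$, $h_j$ up to order). Conjecture I: if two irreducible $E$-functions $h_1,h_2$ have a common zero in $\mathbb C$, then $h_1=uh_2$ for some unit $u$. Conjecture Z: if $\xi\in\mathbb C^*$ and $e^{\beta\xi}\in\overline{\mathbb Q}$ for some $\beta\in\overline{\mathbb Q}^*$, then $h(\xi)\neq0$ for every irreducible $E$-function $h$. *)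

theory Defs
  imports
    "HOL-Analysis.FPS_Convergence"
    "HOL-Computational_Algebra.Computational_Algebra"
    "HOL-Library.Multiset"
begin

abbreviation Qbar :: "complex set" where
  "Qbar \<equiv> {z. algebraic z}"

text \<open>
  The absolute Galois group \<open>Gal(Qbar/\<rat>)\<close>. Its elements are represented by functions on all of
  \<^typ>\<open>complex\<close>, whose values outside \<^const>\<open>Qbar\<close> are irrelevant.
\<close>
definition absolute_Galois_group :: "(complex \<Rightarrow> complex) set" where
  "absolute_Galois_group = {\<sigma>. bij_betw \<sigma> Qbar Qbar \<and>
     (\<forall>x\<in>Qbar. \<forall>y\<in>Qbar. \<sigma> (x + y) = \<sigma> x + \<sigma> y \<and> \<sigma> (x * y) = \<sigma> x * \<sigma> y) \<and>
     (\<forall>q\<in>\<rat>. \<sigma> q = q)}"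

definition Galois_conjugates :: "complex \<Rightarrow> complex set" where
  "Galois_conjugates x = {\<sigma> x | \<sigma>. \<sigma> \<in> absolute_Galois_group}"

text \<open>The field \<open>Qbar(x)\<close>, as a subfield of the field of formal Laurent series.\<close>
definition Qbar_rational_functions :: "complex fls set" where
  "Qbar_rational_functions =
     {fps_to_fls (fps_of_poly P) / fps_to_fls (fps_of_poly Q) | P Q.
        (\<forall>i. poly.coeff P i \<in> Qbar) \<and> (\<forall>i. poly.coeff Q i \<in> Qbar) \<and> Q \<noteq> 0}"

text \<open>
  A formal power series \<open>f\<close> is written \<open>f = \<Sum> a\<^sub>n x\<^sup>n / n!\<close>, so that \<open>a\<^sub>n = n! * f $ n\<close>. The series
  in \<open>E_functions\<close> have infinite radius of convergence, so \<^term>\<open>eval_fps f \<xi>\<close> is the value at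
  \<open>\<xi>\<close> of the entire function \<open>f\<close> for every \<open>\<xi>\<close>.
\<close>
definition E_functions :: "complex fps set" where
  "E_functions = {f.
     (let a = (\<lambda>n. fact n * fps_nth f n) in
       (\<forall>n. a n \<in> Qbar) \<and>
       (\<exists>m c. (\<forall>i\<le>m. c i \<in> Qbar_rational_functions) \<and> (\<exists>i\<le>m. c i \<noteq> 0) \<and>
          (\<Sum>i\<le>m. c i * fps_to_fls ((fps_deriv ^^ i) f)) = 0) \<and>
       (\<exists>C\<^sub>1::real. C\<^sub>1 > 0 \<and> (\<forall>n. \<forall>z\<in>Galois_conjugates (a n). norm z \<le> C\<^sub>1 ^ (n + 1))) \<and>
       (\<exists>(C\<^sub>2::real) (d :: nat \<Rightarrow> nat). C\<^sub>2 > 0 \<and>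
          (\<forall>n. d n > 0 \<and> real (d n) \<le> C\<^sub>2 ^ (n + 1) \<and>
               (\<forall>m\<le>n. algebraic_int (of_nat (d n) * a m)))))}"

definition E_dvd :: "complex fps \<Rightarrow> complex fps \<Rightarrow> bool" where
  "E_dvd g f \<longleftrightarrow> (\<exists>g\<^sub>1\<in>E_functions. f = g * g\<^sub>1)"

definition E_unit :: "complex fps \<Rightarrow> bool" where
  "E_unit u \<longleftrightarrow> u \<in> E_functions \<and> (\<exists>v\<in>E_functions. u * v = 1)"

definition E_irreducible :: "complex fps \<Rightarrow> bool" where
  "E_irreducible f \<longleftrightarrow> f \<in> E_functions \<and> \<not> E_unit f \<and>
     (\<forall>g\<in>E_functions. \<forall>h\<in>E_functions. f = g * h \<longrightarrow> E_unit g \<or> E_unit h)"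

definition rat_span :: "complex \<Rightarrow> complex set" where
  "rat_span \<beta> = {of_rat q * \<beta> | q. True}"

text \<open>
  The function \<open>g\<close> is simple with support \<open>S\<close>. The support is determined by \<open>g\<close>: the exponents
  \<open>\<alpha> + \<beta> r\<^sub>i\<close> are, there are at least two of them, and their differences span \<open>S\<close> over \<open>\<rat>\<close>.
\<close>
definition simple_with_support :: "complex fps \<Rightarrow> complex set \<Rightarrow> bool" where
  "simple_with_support g S \<longleftrightarrow>
     (\<exists>(\<omega>::int) \<alpha> \<beta> (N::nat) (c :: nat \<Rightarrow> complex) (r :: nat \<Rightarrow> rat).
        \<alpha> \<in> Qbar \<and> \<beta> \<in> Qbar \<and> \<beta> \<noteq> 0 \<and> N \<ge> 2 \<and>
        (\<forall>i<N. c i \<in> Qbar \<and> c i \<noteq> 0) \<and> inj_on r {..<N} \<and>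
        fps_to_fls g = fls_X_intpow (-\<omega>) *
          fps_to_fls (fps_exp \<alpha> * (\<Sum>i<N. fps_const (c i) * fps_exp (\<beta> * of_rat (r i)))) \<and>
        fps_nth g 0 \<noteq> 0 \<and>
        S = rat_span \<beta>)"

definition E_simple :: "complex fps \<Rightarrow> bool" where
  "E_simple g \<longleftrightarrow> (\<exists>S. simple_with_support g S)"

definition E_normalized :: "complex fps \<Rightarrow> bool" where
  "E_normalized f \<longleftrightarrow> f \<in> E_functions \<and> f \<noteq> 0 \<and>
     (\<exists>p. (\<forall>i<p. fps_nth f i = 0) \<and> fps_nth f p = 1 \<and> fps_nth f (p + 1) = 0)"

definition normalized_factorization ::
    "complex fps \<Rightarrow> complex fps \<Rightarrow> complex fps list \<Rightarrow> complex fps list \<Rightarrow> bool" where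
  "normalized_factorization f u ss hs \<longleftrightarrow>
     E_unit u \<and>
     (\<forall>s\<in>set ss. E_simple s \<and> E_normalized s) \<and>
     sorted_wrt (\<lambda>s t. \<nexists>S. simple_with_support s S \<and> simple_with_support t S) ss \<and>
     (\<forall>h\<in>set hs. E_irreducible h \<and> E_normalized h) \<and>
     f = u * prod_list ss * prod_list hs"

definition Conjecture_F :: bool where
  "Conjecture_F \<longleftrightarrow>
     (\<forall>f\<in>E_functions. f \<noteq> 0 \<longrightarrow>
        (\<exists>u ss hs. normalized_factorization f u ss hs \<and>
           (\<forall>u' ss' hs'. normalized_factorization f u' ss' hs' \<longrightarrow>
              u' = u \<and> mset ss' = mset ss \<and> mset hs' = mset hs)))"

definition Conjecture_I :: bool where
  "Conjecture_I \<longleftrightarrow>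
     (\<forall>h\<^sub>1 h\<^sub>2. E_irreducible h\<^sub>1 \<and> E_irreducible h\<^sub>2 \<and>
        (\<exists>\<xi>. eval_fps h\<^sub>1 \<xi> = 0 \<and> eval_fps h\<^sub>2 \<xi> = 0) \<longrightarrow>
        (\<exists>u. E_unit u \<and> h\<^sub>1 = u * h\<^sub>2))"

definition Conjecture_Z :: bool where
  "Conjecture_Z \<longleftrightarrow>
     (\<forall>\<xi>. \<xi> \<noteq> 0 \<and> (\<exists>\<beta>\<in>Qbar. \<beta> \<noteq> 0 \<and> exp (\<beta> * \<xi>) \<in> Qbar) \<longrightarrow>
        (\<forall>h. E_irreducible h \<longrightarrow> eval_fps h \<xi> \<noteq> 0))"

end

theory Submission
  imports Defs "Jordan_Normal_Form.Char_Poly"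
begin

text \<open>
  By the factorization conjecture, an \<open>E\<close>-function vanishing at \<open>\<xi>\<close> has an irreducible or a simple
  factor vanishing at \<open>\<xi>\<close>. A zero \<open>\<xi>\<close> of a simple function with exponents in \<open>\<rat>\<beta>\<close> satisfies
  \<open>e\<^sup>\<beta>\<^sup>\<xi> \<in> Qbar\<close>, so by Conjecture Z the two kinds of zeros exclude each other. In the irreducible case
  Conjecture I identifies the factors up to units. In the simple case all supports that occur agree:
  for a suitable algebraic \<open>t\<close> the function \<open>(e\<^sup>\<beta>\<^sup>x - e\<^sup>\<beta>\<^sup>\<xi>) + t (e\<^sup>\<beta>\<^sup>'\<^sup>x - e\<^sup>\<beta>\<^sup>'\<^sup>\<xi>)\<close> again has a simple factor vanishing at
  \<open>\<xi>\<close>, hence at \<open>\<xi> + j\<tau>\<close> for a period \<open>\<tau>\<close>, which forces \<open>e\<^sup>\<beta>\<^sup>\<tau> = e\<^sup>\<beta>\<^sup>'\<^sup>\<tau> = 1\<close> and \<open>\<beta>' \<in> \<rat>\<beta>\<close>. A simple function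
  is then \<open>x\<^sup>-\<^sup>k e\<^sup>\<alpha>\<^sup>x P(y)\<close> with \<open>y = e\<^sup>\<beta>\<^sup>x\<^sup>/\<^sup>N\<close>, and the root of \<open>P\<close> at \<open>e\<^sup>\<beta>\<^sup>\<xi>\<^sup>/\<^sup>N\<close> splits off. Taking \<open>N\<close> so large that
  this root is not \<open>1\<close>, the power of \<open>x\<close> divides the cofactor, and the quotient is an \<open>E\<close>-function because
  \<open>1, \<dots>, n\<close> have a common multiple of exponential size.
\<close>

section \<open>Algebraic integers and algebraic numbers\<close>

locale unital_subring =
  fixes R :: "'a :: comm_ring_1 set"
  assumes one_closed: "1 \<in> R"
    and diff_closed: "x \<in> R \<Longrightarrow> y \<in> R \<Longrightarrow> x - y \<in> R"
    and mult_closed: "x \<in> R \<Longrightarrow> y \<in> R \<Longrightarrow> x * y \<in> R"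
begin

lemma zero_closed: "0 \<in> R"
  using diff_closed[OF one_closed one_closed] by simp

lemma uminus_closed: "x \<in> R \<Longrightarrow> - x \<in> R"
  using diff_closed[OF zero_closed] by simp

lemma add_closed: "x \<in> R \<Longrightarrow> y \<in> R \<Longrightarrow> x + y \<in> R"
  using diff_closed[of x "- y"] uminus_closed by simp

lemma sum_closed: "(\<And>i. i \<in> A \<Longrightarrow> f i \<in> R) \<Longrightarrow> sum f A \<in> R"
  by (induction A rule: infinite_finite_induct) (auto intro: zero_closed add_closed)

lemma power_closed: "x \<in> R \<Longrightarrow> x ^ n \<in> R"
  by (induction n) (auto intro: one_closed mult_closed)

lemma of_nat_closed: "of_nat n \<in> R"
  by (induction n) (auto intro: zero_closed one_closed add_closed)

text \<open>The \<open>R\<close>-submodule generated by \<open>S\<close>, built one term at a time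
  so that closure properties follow by induction. For finite \<open>S\<close>, explicit coefficients
  are recovered in \<open>lin_span_finite_sum\<close>.\<close>

inductive_set lin_span :: "'a set \<Rightarrow> 'a set" for S where
  zero: "0 \<in> lin_span S"
| step: "r \<in> R \<Longrightarrow> s \<in> S \<Longrightarrow> x \<in> lin_span S \<Longrightarrow> r * s + x \<in> lin_span S"

lemma lin_span_base: "s \<in> S \<Longrightarrow> s \<in> lin_span S"
  using step[OF one_closed _ zero, of s S] by simp

lemma lin_span_add: "x \<in> lin_span S \<Longrightarrow> y \<in> lin_span S \<Longrightarrow> x + y \<in> lin_span S"
  by (induction rule: lin_span.induct) (auto simp: add.assoc intro: step)

lemma lin_span_scale: "x \<in> lin_span S \<Longrightarrow> r \<in> R \<Longrightarrow> r * x \<in> lin_span S"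
proof (induction rule: lin_span.induct)
  case (step a s x)
  then have "(r * a) * s + r * x \<in> lin_span S"
    by (intro lin_span.step mult_closed) auto
  then show ?case by (simp add: algebra_simps)
qed (simp add: zero)

lemma lin_span_sum: "(\<And>i. i \<in> A \<Longrightarrow> f i \<in> lin_span S) \<Longrightarrow> sum f A \<in> lin_span S"
  by (induction A rule: infinite_finite_induct) (auto intro: zero lin_span_add)

lemma lin_span_mono: "S \<subseteq> T \<Longrightarrow> x \<in> lin_span S \<Longrightarrow> x \<in> lin_span T"
  by (rotate_tac, induction rule: lin_span.induct) (auto intro: lin_span.intros)

text \<open>Multiplication by \<open>y\<close> is \<open>R\<close>-linear, so its effect on a span
  can be checked on generators.\<close>

lemma lin_span_image:
  assumes "x \<in> lin_span S" "\<And>s. s \<in> S \<Longrightarrow> y * s \<in> lin_span T"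
  shows "y * x \<in> lin_span T"
  using assms(1)
proof (induction rule: lin_span.induct)
  case (step r s x)
  then have "r * (y * s) + y * x \<in> lin_span T"
    using assms(2) lin_span_add lin_span_scale by blast
  then show ?case by (simp add: algebra_simps)
qed (simp add: zero)

lemma lin_span_mult:
  assumes "x \<in> lin_span S" "y \<in> lin_span T"
  shows "x * y \<in> lin_span {s * t |s t. s \<in> S \<and> t \<in> T}"
proof (rule lin_span_image[OF assms(2)])
  fix t assume "t \<in> T"
  have "t * x \<in> lin_span {s * t |s t. s \<in> S \<and> t \<in> T}"
    using \<open>t \<in> T\<close> by (intro lin_span_image[OF assms(1)] lin_span_base) (auto simp: mult.commute)
  then show "x * t \<in> lin_span {s * t |s t. s \<in> S \<and> t \<in> T}"
    by (simp add: mult.commute)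
qed

lemma lin_span_finite_sum:
  assumes "x \<in> lin_span S" "finite S"
  obtains r where "\<And>s. r s \<in> R" "x = (\<Sum>s\<in>S. r s * s)"
proof -
  from assms(1) have "\<exists>r. (\<forall>s. r s \<in> R) \<and> x = (\<Sum>s\<in>S. r s * s)"
  proof (induction rule: lin_span.induct)
    case zero
    show ?case by (intro exI[of _ "\<lambda>_. 0"]) (auto intro: zero_closed)
  next
    case (step a t x)
    then obtain r where r: "\<And>s. r s \<in> R" "x = (\<Sum>s\<in>S. r s * s)" by blast
    have "(\<Sum>s\<in>S. (r s + (if s = t then a else 0)) * s)
        = x + (\<Sum>s\<in>S. if s = t then a * s else 0)"
      unfolding r(2) sum.distrib[symmetric] by (intro sum.cong) (auto simp: algebra_simps)
    also have "\<dots> = a * t + x"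
      using assms(2) step.hyps(2) by (simp add: sum.delta)
    finally show ?case
      using r(1) step.hyps(1)
      by (intro exI[of _ "\<lambda>s. r s + (if s = t then a else 0)"]) (auto intro: add_closed)
  qed
  then show ?thesis using that by blast
qed

text \<open>The new generators are the products x^j * s with j < n and s in \<open>S\<close>; the
  monic equation rewrites x^n. The coefficients only have to act on the span, so integer equations
  and equations over algebraic integers are both covered. The last conclusion keeps earlier
  multipliers stable, so elements can be adjoined one after another.\<close>

lemma adjoin_integral:
  assumes S: "finite S" "1 \<in> lin_span S"
    and x: "x ^ n = (\<Sum>i<n. c i * x ^ i)"
    and c: "\<And>i s. i < n \<Longrightarrow> s \<in> S \<Longrightarrow> c i * s \<in> lin_span S"
  obtains S' where "finite S'" "1 \<in> lin_span S'" "\<And>s. s \<in> S' \<Longrightarrow> x * s \<in> lin_span S'"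
    "\<And>y s. (\<And>s. s \<in> S \<Longrightarrow> y * s \<in> lin_span S) \<Longrightarrow> s \<in> S' \<Longrightarrow> y * s \<in> lin_span S'"
proof (cases "n = 0")
  case True
  with x have "(1::'a) = 0" by simp
  then have "z = 0" for z :: 'a by (metis mult_1 mult_zero_left)
  then have "z \<in> lin_span {}" for z :: 'a using zero[of "{}"] by metis
  then show ?thesis by (intro that[of "{}"]) auto
next
  case False
  define S' where "S' = (\<lambda>(s, j). x ^ j * s) ` (S \<times> {..<n})"
  have shift: "x ^ j * u \<in> lin_span S'" if "j < n" "u \<in> lin_span S" for j u
    using that by (intro lin_span_image[OF that(2)] lin_span_base) (auto simp: S'_def)
  show ?thesis
  proof
    show "finite S'" using S by (auto simp: S'_def)
    show "1 \<in> lin_span S'" using shift[of 0 1] S False by simp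
    fix t assume "t \<in> S'"
    then obtain s j where t: "t = x ^ j * s" "s \<in> S" "j < n" by (auto simp: S'_def)
    show "x * t \<in> lin_span S'"
    proof (cases "Suc j < n")
      case True
      then have "x ^ Suc j * s \<in> lin_span S'" using t by (intro shift lin_span_base)
      then show ?thesis by (simp add: t algebra_simps)
    next
      case False
      then have "Suc j = n" using t by simp
      then have "x * t = x ^ n * s" by (auto simp: t algebra_simps)
      also have "\<dots> = (\<Sum>i<n. x ^ i * (c i * s))"
        unfolding x sum_distrib_right by (intro sum.cong) auto
      also have "\<dots> \<in> lin_span S'"
        using t c by (intro lin_span_sum shift) auto
      finally show ?thesis .
    qed
    fix y assume "\<And>s. s \<in> S \<Longrightarrow> y * s \<in> lin_span S"
    then have "x ^ j * (y * s) \<in> lin_span S'" using t by (intro shift)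
    then show "y * t \<in> lin_span S'" by (simp add: t algebra_simps)
  qed
qed

end

section \<open>Integrality through finitely generated modules\<close>

interpretation ints: unital_subring "\<int> :: 'a :: comm_ring_1 set"
  by unfold_locales auto

text \<open>Determinant trick: multiplication by \<open>x\<close> acts on the generators through an
  integer matrix, so \<open>x\<close> is an eigenvalue with the vector of generators as eigenvector,
  and hence a root of a monic integer characteristic polynomial.\<close>

lemma algebraic_int_if_module:
  fixes x :: "'a :: field_char_0"
  assumes S: "finite S" "1 \<in> ints.lin_span S" and x: "\<And>s. s \<in> S \<Longrightarrow> x * s \<in> ints.lin_span S"
  shows "algebraic_int x"
proof -
  define n where "n = card S"
  obtain f where f: "bij_betw f {0..<n} S"
    using ex_bij_betw_nat_finite[OF S(1)] by (auto simp: n_def)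
  have "\<exists>a. \<forall>i<n. x * f i = (\<Sum>j\<in>{0..<n}. of_int (a i j) * f j)"
  proof -
    have "\<exists>b. x * f i = (\<Sum>j\<in>{0..<n}. of_int (b j) * f j)" if "i < n" for i
    proof -
      have "f i \<in> S" using that f by (auto simp: bij_betw_def)
      from x[OF this] obtain r where r: "\<And>s. r s \<in> \<int>" "x * f i = (\<Sum>s\<in>S. r s * s)"
        using ints.lin_span_finite_sum[OF _ S(1)] by metis
      obtain b where b: "\<And>s. r s = of_int (b s)" using r(1) unfolding Ints_def image_def
        by simp metis
      have "x * f i = (\<Sum>j\<in>{0..<n}. r (f j) * f j)"
        unfolding r(2) by (rule sum.reindex_bij_betw[OF f, symmetric])
      then show ?thesis by (intro exI[of _ "b \<circ> f"]) (simp add: b)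
    qed
    then show ?thesis by (intro choice) auto
  qed
  then obtain a where a: "\<And>i. i < n \<Longrightarrow> x * f i = (\<Sum>j\<in>{0..<n}. of_int (a i j) * f j)" by blast
  define A :: "int mat" where "A = mat n n (\<lambda>(i, j). a i j)"
  define B :: "'a mat" where "B = map_mat of_int A"
  have A: "A \<in> carrier_mat n n" and B: "B \<in> carrier_mat n n" by (auto simp: A_def B_def)
  \<comment> \<open>An eigenvector must be non-zero; this holds because the generators span
    1.\<close>
  have "\<exists>i<n. f i \<noteq> 0"
  proof (rule ccontr)
    assume "\<not> ?thesis"
    then have "S \<subseteq> {0}" using f by (force simp: bij_betw_def)
    then have "1 \<in> ints.lin_span {0::'a}" using S(2) ints.lin_span_mono by blast
    then obtain r :: "'a \<Rightarrow> 'a" where "1 = (\<Sum>s\<in>{0}. r s * s)"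
      by (rule ints.lin_span_finite_sum) auto
    then show False by simp
  qed
  then have "vec n f \<noteq> 0\<^sub>v n" by (auto simp: vec_eq_iff)
  moreover have "B *\<^sub>v vec n f = x \<cdot>\<^sub>v vec n f"
    by (rule eq_vecI) (auto simp: B_def A_def scalar_prod_def a)
  ultimately have "eigenvalue B x"
    unfolding eigenvalue_def eigenvector_def by (intro exI[of _ "vec n f"]) (auto simp: B_def A_def)
  then have "poly (char_poly B) x = 0"
    using eigenvalue_root_char_poly[OF B] by simp
  moreover have "char_poly B = map_poly of_int (char_poly A)"
    unfolding B_def by (rule of_int_hom.char_poly_hom[OF A])
  moreover have "lead_coeff (char_poly A) = 1" using degree_monic_char_poly[OF A] by simp
  ultimately show ?thesis unfolding algebraic_int_altdef_ipoly by metis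
qed

text \<open>Starting from the generator 1, the elements of \<open>Y\<close> are adjoined one by one
  with \<open>adjoin_integral\<close>.\<close>

lemma finite_module_of_algebraic_ints:
  fixes Y :: "'a :: field_char_0 set"
  assumes "finite Y" "\<And>y. y \<in> Y \<Longrightarrow> algebraic_int y"
  obtains S where "finite S" "1 \<in> ints.lin_span S" "\<And>y s. y \<in> Y \<Longrightarrow> s \<in> S \<Longrightarrow> y * s \<in> ints.lin_span S"
proof -
  have "\<exists>S. finite S \<and> 1 \<in> ints.lin_span S \<and> (\<forall>y\<in>Y. \<forall>s\<in>S. y * s \<in> ints.lin_span S)"
    using assms
  proof (induction Y rule: finite_induct)
    case empty
    show ?case by (intro exI[of _ "{1}"]) (auto intro: ints.lin_span_base)
  next
    case (insert x Y)
    then obtain S where S: "finite S" "1 \<in> ints.lin_span S"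
      "\<And>y s. y \<in> Y \<Longrightarrow> s \<in> S \<Longrightarrow> y * s \<in> ints.lin_span S" by auto
    from insert.prems[of x] obtain p where p: "lead_coeff p = 1" "\<forall>i. poly.coeff p i \<in> \<int>" "poly p x = 0"
      by (auto elim: algebraic_int.cases)
    define n where "n = Polynomial.degree p"
    have "0 = (\<Sum>i\<le>n. poly.coeff p i * x ^ i)" using p(3) by (simp add: poly_altdef n_def)
    also have "\<dots> = x ^ n + (\<Sum>i<n. poly.coeff p i * x ^ i)"
      using p(1) by (simp add: lessThan_Suc_atMost[symmetric] n_def)
    finally have "x ^ n = (\<Sum>i<n. - poly.coeff p i * x ^ i)"
      by (simp add: sum_negf eq_neg_iff_add_eq_0)
    from ints.adjoin_integral[OF S(1,2) this] obtain S' where S':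
      "finite S'" "1 \<in> ints.lin_span S'" "\<And>s. s \<in> S' \<Longrightarrow> x * s \<in> ints.lin_span S'"
      "\<And>y s. (\<And>s. s \<in> S \<Longrightarrow> y * s \<in> ints.lin_span S) \<Longrightarrow> s \<in> S' \<Longrightarrow> y * s \<in> ints.lin_span S'"
      using p(2) by (metis Ints_minus ints.lin_span_base ints.lin_span_scale)
    then show ?case using S(3) by (intro exI[of _ S']) auto
  qed
  then show ?thesis using that by blast
qed

text \<open>A finite module stable under both \<open>x\<close> and \<open>y\<close> is stable under
  their sum and product.\<close>

lemma
  fixes x y :: "'a :: field_char_0"
  assumes "algebraic_int x" "algebraic_int y"
  shows algebraic_int_add: "algebraic_int (x + y)"
    and algebraic_int_mult: "algebraic_int (x * y)"
proof -
  obtain S where S: "finite S" "1 \<in> ints.lin_span S"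
    "\<And>z s. z \<in> {x, y} \<Longrightarrow> s \<in> S \<Longrightarrow> z * s \<in> ints.lin_span S"
    using finite_module_of_algebraic_ints[of "{x, y}"] assms by blast
  show "algebraic_int (x + y)"
    using S(3) by (intro algebraic_int_if_module[OF S(1,2)]) (auto simp: distrib_right intro: ints.lin_span_add)
  show "algebraic_int (x * y)"
  proof (rule algebraic_int_if_module[OF S(1,2)])
    fix s assume "s \<in> S"
    then have "x * (y * s) \<in> ints.lin_span S"
      using S(3) ints.lin_span_image[of "y * s" S x S] by simp
    then show "x * y * s \<in> ints.lin_span S" by (simp add: mult.assoc)
  qed
qed

lemma algebraic_int_of_nat: "algebraic_int (of_nat n :: 'a :: field_char_0)"
  by (simp add: int_imp_algebraic_int)

lemma algebraic_int_power: "algebraic_int (x :: 'a :: field_char_0) \<Longrightarrow> algebraic_int (x ^ n)"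
  by (induction n) (auto intro: algebraic_int_mult int_imp_algebraic_int)

lemma algebraic_int_sum:
  "(\<And>i. i \<in> A \<Longrightarrow> algebraic_int (f i :: 'a :: field_char_0)) \<Longrightarrow> algebraic_int (sum f A)"
  by (induction A rule: infinite_finite_induct) (auto intro: algebraic_int_add)

text \<open>Transitivity of integrality: a finite module stable under all coefficients is enlarged
  to one stable under \<open>x\<close>.\<close>

lemma algebraic_int_root_of_monic:
  fixes x :: "'a :: field_char_0"
  assumes x: "x ^ n = (\<Sum>i<n. c i * x ^ i)" and c: "\<And>i. i < n \<Longrightarrow> algebraic_int (c i)"
  shows "algebraic_int x"
proof -
  obtain S where S: "finite S" "1 \<in> ints.lin_span S"
    "\<And>z s. z \<in> c ` {..<n} \<Longrightarrow> s \<in> S \<Longrightarrow> z * s \<in> ints.lin_span S"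
    using finite_module_of_algebraic_ints[of "c ` {..<n}"] c by blast
  obtain S' where "finite S'" "1 \<in> ints.lin_span S'" "\<And>s. s \<in> S' \<Longrightarrow> x * s \<in> ints.lin_span S'"
    by (rule ints.adjoin_integral[OF S(1,2) x]) (use S(3) in auto)
  then show ?thesis by (rule algebraic_int_if_module)
qed

text \<open>Multiplying an integer equation of degree n for \<open>x\<close> by the (n-1)-th power
  of its leading coefficient z turns it into a monic equation for z * x. Passing to the absolute
  value of z gives a positive natural number.\<close>

lemma algebraic_int_multiple:
  fixes x :: "'a :: field_char_0"
  assumes "algebraic x"
  obtains d :: nat where "d > 0" "algebraic_int (of_nat d * x)"
proof -
  have scaled: "algebraic_int (z * x)"
    if z: "z \<in> \<int>" and p: "z = lead_coeff p" "\<And>i. poly.coeff p i \<in> \<int>" "p \<noteq> 0" "poly p x = 0" for z p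
  proof -
    define n where "n = Polynomial.degree p"
    have "n \<noteq> 0" using p by (auto simp: n_def elim!: degree_eq_zeroE)
    have "0 = z ^ (n - 1) * (\<Sum>i\<le>n. poly.coeff p i * x ^ i)" using p(4) by (simp add: poly_altdef n_def)
    also have "\<dots> = z ^ (n - 1) * (z * x ^ n) + (\<Sum>i<n. z ^ (n - 1) * (poly.coeff p i * x ^ i))"
      by (simp add: lessThan_Suc_atMost[symmetric] n_def p(1) distrib_left sum_distrib_left)
    also have "z ^ (n - 1) * (z * x ^ n) = (z * x) ^ n"
      using \<open>n \<noteq> 0\<close> by (cases n) (simp_all add: power_mult_distrib)
    also have "(\<Sum>i<n. z ^ (n - 1) * (poly.coeff p i * x ^ i))
        = (\<Sum>i<n. z ^ (n - 1 - i) * poly.coeff p i * (z * x) ^ i)"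
    proof (rule sum.cong)
      fix i assume "i \<in> {..<n}"
      then have "z ^ (n - 1) = z ^ (n - 1 - i) * z ^ i" by (simp flip: power_add)
      then show "z ^ (n - 1) * (poly.coeff p i * x ^ i) = z ^ (n - 1 - i) * poly.coeff p i * (z * x) ^ i"
        by (simp add: power_mult_distrib)
    qed simp
    finally have "(z * x) ^ n = (\<Sum>i<n. - (z ^ (n - 1 - i) * poly.coeff p i) * (z * x) ^ i)"
      by (simp add: sum_negf eq_neg_iff_add_eq_0)
    then show ?thesis
      by (rule algebraic_int_root_of_monic) (use z p in \<open>auto intro!: int_imp_algebraic_int\<close>)
  qed
  obtain p where p: "\<And>i. poly.coeff p i \<in> \<int>" "p \<noteq> 0" "poly p x = 0"
    using assms unfolding algebraic_def by blast
  obtain k where k: "lead_coeff p = of_int k" using p(1) by (metis Ints_cases)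
  have "algebraic_int (of_int k * x)" by (rule scaled[of _ p]) (use p k in auto)
  then have "algebraic_int (of_int \<bar>k\<bar> * x)" by (cases "k \<ge> 0") auto
  moreover have "of_int \<bar>k\<bar> = (of_nat (nat \<bar>k\<bar>) :: 'a)" by simp
  ultimately have "algebraic_int (of_nat (nat \<bar>k\<bar>) * x)" by (simp only:)
  moreover have "nat \<bar>k\<bar> > 0" using k p(2) by auto
  ultimately show ?thesis by (rule that[rotated])
qed

lemma algebraic_if_algebraic_int_multiple:
  fixes x :: "'a :: field_char_0"
  assumes "algebraic_int (of_nat d * x)" "d > 0"
  shows "algebraic x"
proof -
  obtain p where p: "p \<noteq> 0" "\<And>i. poly.coeff p i \<in> \<int>" "poly p (of_nat d * x) = 0"
    using algebraic_int_imp_algebraic[OF assms(1)] unfolding algebraic_def by blast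
  define q where "q = pcompose p [:0, of_nat d :: 'a:]"
  show ?thesis
  proof (rule algebraicI)
    show "q \<noteq> 0" using p(1) assms(2) by (auto simp: q_def pcompose_eq_0_iff)
    show "poly q x = 0" using p(3) by (simp add: q_def poly_pcompose mult.commute)
    show "poly.coeff q i \<in> \<int>" for i
      unfolding q_def using p(2)
      by (intro coeff_pcompose_semiring_closed) (auto simp: coeff_pCons split: nat.splits)
  qed
qed

lemma
  fixes x y :: "'a :: field_char_0"
  assumes "algebraic x" "algebraic y"
  shows algebraic_add: "algebraic (x + y)" and algebraic_mult: "algebraic (x * y)"
proof -
  obtain d e :: nat where d: "d > 0" "algebraic_int (of_nat d * x)"
    and e: "e > 0" "algebraic_int (of_nat e * y)"
    using assms by (metis algebraic_int_multiple)
  have "algebraic_int (of_nat e * (of_nat d * x) + of_nat d * (of_nat e * y))"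
    using algebraic_int_add algebraic_int_mult[OF algebraic_int_of_nat] d(2) e(2) by blast
  then have "algebraic_int (of_nat (d * e) * (x + y))" by (simp add: algebra_simps)
  then show "algebraic (x + y)"
    by (rule algebraic_if_algebraic_int_multiple) (use d e in simp)
  have "algebraic_int (of_nat d * x * (of_nat e * y))"
    using d e algebraic_int_mult by blast
  then have "algebraic_int (of_nat (d * e) * (x * y))" by (simp add: algebra_simps)
  then show "algebraic (x * y)"
    by (rule algebraic_if_algebraic_int_multiple) (use d e in simp)
qed

lemma algebraic_divide: "algebraic x \<Longrightarrow> algebraic y \<Longrightarrow> algebraic (x / y :: 'a :: field_char_0)"
  unfolding divide_inverse by (intro algebraic_mult algebraic_inverse)

interpretation Qbar: unital_subring Qbar
proof
  fix x y :: complex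
  assume "x \<in> Qbar" "y \<in> Qbar"
  then show "x - y \<in> Qbar" "x * y \<in> Qbar"
    using algebraic_add[of x "- y"] algebraic_mult[of x y] by auto
qed simp

text \<open>\<open>Qbar\<close> is algebraically closed: after normalizing the leading coefficient,
  a common denominator d of the other coefficients makes d * x a root of a monic equation over the
  algebraic integers.\<close>

lemma algebraic_if_root:
  fixes x :: "'a :: field_char_0"
  assumes p: "p \<noteq> 0" "poly p x = 0" "\<And>i. algebraic (poly.coeff p i)"
  shows "algebraic x"
proof -
  define n where "n = Polynomial.degree p"
  define c where "c = (\<lambda>i. - (poly.coeff p i / lead_coeff p))"
  have c: "algebraic (c i)" for i
    unfolding c_def by (intro algebraic_minus algebraic_divide p)
  have "0 = (\<Sum>i\<le>n. poly.coeff p i * x ^ i)" using p(2) by (simp add: poly_altdef n_def)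
  also have "\<dots> = lead_coeff p * x ^ n + (\<Sum>i<n. poly.coeff p i * x ^ i)"
    by (simp add: lessThan_Suc_atMost[symmetric] n_def)
  finally have xn: "x ^ n = (\<Sum>i<n. c i * x ^ i)"
    using p(1) by (simp add: c_def sum_negf sum_divide_distrib[symmetric] field_simps eq_neg_iff_add_eq_0)
  have "\<exists>d::nat. d > 0 \<and> (\<forall>i<m. algebraic_int (of_nat d * c i))" for m
  proof (induction m)
    case (Suc m)
    then obtain d :: nat where d: "d > 0" "\<forall>i<m. algebraic_int (of_nat d * c i)" by blast
    obtain e :: nat where e: "e > 0" "algebraic_int (of_nat e * c m)"
      using algebraic_int_multiple[OF c] by blast
    have "algebraic_int (of_nat e * (of_nat d * c i))" if "i < m" for i
      using algebraic_int_mult[OF algebraic_int_of_nat] d that by blast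
    moreover have "algebraic_int (of_nat d * (of_nat e * c m))"
      using algebraic_int_mult[OF algebraic_int_of_nat] e by blast
    ultimately show ?case using d e
      by (intro exI[of _ "d * e"]) (auto simp: less_Suc_eq algebra_simps)
  qed auto
  then obtain d :: nat where d: "d > 0" "\<And>i. i < n \<Longrightarrow> algebraic_int (of_nat d * c i)" by blast
  have "(of_nat d * x) ^ n = (\<Sum>i<n. of_nat d ^ n * (c i * x ^ i))"
    by (simp add: power_mult_distrib xn sum_distrib_left)
  also have "\<dots> = (\<Sum>i<n. of_nat d ^ (n - i) * c i * (of_nat d * x) ^ i)"
  proof (rule sum.cong)
    fix i assume "i \<in> {..<n}"
    then have "(of_nat d :: 'a) ^ n = of_nat d ^ (n - i) * of_nat d ^ i" by (simp flip: power_add)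
    then show "of_nat d ^ n * (c i * x ^ i) = of_nat d ^ (n - i) * c i * (of_nat d * x) ^ i"
      by (simp add: power_mult_distrib)
  qed simp
  finally have "(of_nat d * x) ^ n = (\<Sum>i<n. of_nat d ^ (n - i) * c i * (of_nat d * x) ^ i)" .
  then have "algebraic_int (of_nat d * x)"
  proof (rule algebraic_int_root_of_monic)
    fix i assume "i < n"
    then have "of_nat d ^ (n - i) * c i = of_nat d ^ (n - i - 1) * (of_nat d * c i)"
      by (cases "n - i") auto
    also have "algebraic_int \<dots>"
      using algebraic_int_mult algebraic_int_power algebraic_int_of_nat d(2)[OF \<open>i < n\<close>] by blast
    finally show "algebraic_int (of_nat d ^ (n - i) * c i)" .
  qed
  then show ?thesis using d by (auto intro: algebraic_if_algebraic_int_multiple)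
qed

section \<open>A common multiple of exponential size\<close>

text \<open>By absorption, p^e divides k * (p^e choose k). If p did not divide the binomial
  coefficient, p^e would divide k, which is too small.\<close>

lemma prime_dvd_prime_power_choose:
  assumes "prime (p::nat)" "0 < k" "k < p ^ e"
  shows "p dvd (p ^ e choose k)"
proof (rule ccontr)
  assume "\<not> ?thesis"
  then have "coprime (p ^ e) (p ^ e choose k)"
    using assms(1) by (simp add: prime_imp_coprime)
  moreover have "p ^ e dvd k * (p ^ e choose k)"
    using assms(2) by (simp add: times_binomial_minus1_eq)
  ultimately have "p ^ e dvd k" by (simp add: coprime_dvd_mult_left_iff)
  with assms show False by (auto dest: dvd_imp_le)
qed

text \<open>
  By Vandermonde's identity, \<open>(1 + X)\<^sup>2\<^sup>n \<equiv> (1 + X\<^sup>q) (1 + X)\<^sup>2\<^sup>n\<^sup>-\<^sup>q\<close> modulo \<open>p\<close> for \<open>q = p\<^sup>e\<close>.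
\<close>
lemma prime_dvd_central_binomial:
  assumes p: "prime (p::nat)" and q: "n < p ^ e" "p ^ e \<le> 2 * n"
  shows "p dvd (2 * n choose n)"
proof -
  define q where "q = p ^ e"
  have "(2 * n choose n) = (\<Sum>k\<le>n. (q choose k) * (2 * n - q choose (n - k)))"
    using vandermonde[of q "2 * n - q" n] q by (simp add: q_def)
  also have "p dvd \<dots>"
  proof (rule dvd_sum)
    fix k assume k: "k \<in> {..n}"
    show "p dvd (q choose k) * (2 * n - q choose (n - k))"
    proof (cases "k = 0")
      case True
      \<comment> \<open>Here 2n - q < n, so the second binomial coefficient vanishes.\<close>
      then show ?thesis using q by (simp add: q_def binomial_eq_0)
    next
      case False
      then show ?thesis
        using prime_dvd_prime_power_choose[OF p, of k e] k q by (simp add: q_def)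
    qed
  qed
  finally show ?thesis .
qed

text \<open>Compare prime powers. A power p^e dividing m either is at most n and divides d, or lies
  in (n, 2n]; then p^(e-1) is at most n and divides d, and the central binomial coefficient supplies
  the missing factor p.\<close>

lemma all_dvd_central_binomial_mult:
  assumes d: "\<And>j. 1 \<le> j \<Longrightarrow> j \<le> n \<Longrightarrow> j dvd d" "d > 0" and m: "1 \<le> m" "m \<le> 2 * n"
  shows "m dvd (2 * n choose n) * d"
proof (rule multiplicity_le_imp_dvd)
  fix p :: nat assume p: "prime p"
  define e where "e = multiplicity p m"
  have pe: "p ^ e \<le> 2 * n"
    using multiplicity_dvd[of p m] m by (auto simp: e_def dest: dvd_imp_le)
  have "p ^ e dvd (2 * n choose n) * d"
  proof (cases "p ^ e \<le> n")
    case True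
    then show ?thesis using d(1)[of "p ^ e"] p by (simp add: prime_gt_0_nat Suc_le_eq)
  next
    case False
    then have "e \<noteq> 0" using m by (cases e) auto
    then obtain e' where e': "e = Suc e'" by (cases e) auto
    have "2 * p ^ e' \<le> p * p ^ e'" using prime_ge_2_nat[OF p] by (intro mult_right_mono) auto
    then have "p ^ e' \<le> n" using pe unfolding e' power_Suc by linarith
    then have "p ^ e' dvd d" using d(1)[of "p ^ e'"] p by (simp add: prime_gt_0_nat Suc_le_eq)
    moreover have "p dvd (2 * n choose n)"
      using prime_dvd_central_binomial[OF p, of n e] False pe by simp
    ultimately show ?thesis unfolding e' power_Suc by (intro mult_dvd_mono)
  qed
  moreover have "(2 * n choose n) * d \<noteq> 0" using d(2) by simp
  ultimately show "multiplicity p m \<le> multiplicity p ((2 * n choose n) * d)"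
    using p by (intro multiplicity_geI) (auto simp: e_def)
qed (use m in auto)

text \<open>Induction by halving: passing from m to 2m costs only the factor (2m choose m) <=
  4^m.\<close>

lemma exponential_common_multiple:
  "\<exists>d::nat. d > 0 \<and> d \<le> 16 ^ n \<and> (\<forall>m. 1 \<le> m \<and> m \<le> n \<longrightarrow> m dvd d)"
proof (induction n rule: less_induct)
  case (less n)
  show ?case
  proof (cases "n \<le> 2")
    case True
    then have "n = 0 \<or> n = 1 \<or> n = 2" by auto
    moreover have "m dvd n" if "1 \<le> m" "m \<le> n" for m
    proof -
      from that True have "m = 1 \<or> m = n" by auto
      then show ?thesis by auto
    qed
    ultimately show ?thesis
      by (cases "n = 0") (auto intro: exI[of _ 1] exI[of _ n])
  next
    case False
    \<comment> \<open>\<open>m\<close> is n/2 rounded up. The bound closes because 4^m * 16^m =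
      2^(6m) and 6m <= 3n + 3 <= 4n, which is where n >= 3 enters.\<close>
    define m where "m = (n + 1) div 2"
    have m: "m < n" "n \<le> 2 * m" "2 * m \<le> n + 1" "2 \<le> m" using False by (auto simp: m_def)
    from less[OF m(1)] obtain d where
      d: "d > 0" "d \<le> 16 ^ m" "\<And>j. 1 \<le> j \<Longrightarrow> j \<le> m \<Longrightarrow> j dvd d" by blast
    have "(2 * m choose m) * d \<le> 2 ^ (2 * m) * 16 ^ m"
      using d by (intro mult_mono) (auto intro: binomial_le_pow2)
    also have "\<dots> = (2::nat) ^ (6 * m)" by (simp add: power_mult power_mult_distrib[symmetric])
    also have "\<dots> \<le> 2 ^ (4 * n)" using m by (intro power_increasing) auto
    also have "\<dots> = 16 ^ n" by (simp add: power_mult)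
    finally have "(2 * m choose m) * d \<le> 16 ^ n" .
    moreover have "j dvd (2 * m choose m) * d" if "1 \<le> j" "j \<le> n" for j
      using all_dvd_central_binomial_mult[of m d j] d that m by auto
    ultimately show ?thesis using d(1) by (intro exI[of _ "(2 * m choose m) * d"]) auto
  qed
qed

section \<open>Differentially finite Laurent series\<close>

locale unital_subfield = unital_subring R for R :: "'a :: field set" +
  assumes inverse_closed: "x \<in> R \<Longrightarrow> inverse x \<in> R"
begin

lemma divide_closed: "x \<in> R \<Longrightarrow> y \<in> R \<Longrightarrow> x / y \<in> R"
  unfolding divide_inverse by (intro mult_closed inverse_closed)

text \<open>Gaussian elimination of one generator \<open>s\<close> at a time: an element
  \<open>f k\<close> with non-zero coefficient at \<open>s\<close> serves as pivot and is removed
  after clearing \<open>s\<close> from the others.\<close>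

lemma linear_dependence:
  assumes "finite S" "finite I" "card S < card I" "\<And>i. i \<in> I \<Longrightarrow> f i \<in> lin_span S"
  shows "\<exists>c. (\<forall>i. c i \<in> R) \<and> (\<exists>i\<in>I. c i \<noteq> 0) \<and> (\<Sum>i\<in>I. c i * f i) = 0"
  using assms
proof (induction S arbitrary: I f rule: finite_induct)
  case empty
  have "f i = 0" if "i \<in> I" for i
    using lin_span_finite_sum[OF empty.prems(3)[OF that]] by auto
  moreover have "I \<noteq> {}" using empty by auto
  ultimately show ?case by (intro exI[of _ "\<lambda>_. 1"]) (auto intro: one_closed)
next
  case (insert s S)
  have "\<forall>i. \<exists>a. i \<in> I \<longrightarrow> a \<in> R \<and> f i - a * s \<in> lin_span S"
  proof
    fix i
    show "\<exists>a. i \<in> I \<longrightarrow> a \<in> R \<and> f i - a * s \<in> lin_span S"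
    proof (cases "i \<in> I")
      case True
      then obtain r where r: "\<And>t. r t \<in> R" "f i = (\<Sum>t\<in>insert s S. r t * t)"
        using lin_span_finite_sum insert.prems(3) insert.hyps(1) by (metis finite_insert)
      then have "f i - r s * s = (\<Sum>t\<in>S. r t * t)" using insert.hyps by simp
      also have "\<dots> \<in> lin_span S" using r by (intro lin_span_sum lin_span_scale lin_span_base)
      finally show ?thesis using r by blast
    qed auto
  qed
  then obtain a where a: "\<And>i. i \<in> I \<Longrightarrow> a i \<in> R" "\<And>i. i \<in> I \<Longrightarrow> f i - a i * s \<in> lin_span S"
    by metis
  have card_S: "card S < card I - 1" using insert by simp
  show ?case
  proof (cases "\<exists>k\<in>I. a k \<noteq> 0")
    case False
    then have "f i \<in> lin_span S" if "i \<in> I" for i using a(2)[OF that] that by simp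
    then show ?thesis using insert.IH[of I f] insert.prems card_S by auto
  next
    case True
    then obtain k where k: "k \<in> I" "a k \<noteq> 0" by blast
    define b where "b = (\<lambda>i. if i \<in> I then a i / a k else 0)"
    have b: "b i \<in> R" for i using a k by (auto simp: b_def intro: divide_closed zero_closed)
    have "f i - b i * f k \<in> lin_span S" if "i \<in> I - {k}" for i
    proof -
      have "f i - b i * f k = (f i - a i * s) + (- b i) * (f k - a k * s)"
        using k that by (simp add: b_def algebra_simps)
      also have "\<dots> \<in> lin_span S"
        using a k that b by (intro lin_span_add lin_span_scale uminus_closed) auto
      finally show ?thesis .
    qed
    then obtain c where c: "\<And>i. c i \<in> R" "\<exists>i\<in>I - {k}. c i \<noteq> 0"
      "(\<Sum>i\<in>I - {k}. c i * (f i - b i * f k)) = 0"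
      using insert.IH[of "I - {k}" "\<lambda>i. f i - b i * f k"] insert.prems card_S k by auto
    \<comment> \<open>The entry at \<open>k\<close> collects the multiples of the pivot that were
      subtracted from the other elements.\<close>
    define c' where "c' = c(k := - (\<Sum>i\<in>I - {k}. c i * b i))"
    have "(\<Sum>i\<in>I. c' i * f i) = c' k * f k + (\<Sum>i\<in>I - {k}. c' i * f i)"
      using insert.prems(1) k(1) by (rule sum.remove)
    also have "\<dots> = (\<Sum>i\<in>I - {k}. c i * (f i - b i * f k))"
      by (simp add: c'_def sum_distrib_right right_diff_distrib sum_subtractf mult.assoc)
    finally have "(\<Sum>i\<in>I. c' i * f i) = 0" using c by simp
    moreover have "c' i \<in> R" for i
      using c b by (auto simp: c'_def intro!: uminus_closed sum_closed mult_closed)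
    ultimately show ?thesis using c(2) by (intro exI[of _ c']) (auto simp: c'_def)
  qed
qed

end

lemma (in unital_subring) fraction_subfield:
  fixes emb :: "'a \<Rightarrow> 'b :: field"
  assumes inj: "\<And>x. emb x = 0 \<longleftrightarrow> x = 0"
    and hom: "emb 1 = 1" "\<And>x y. emb (x - y) = emb x - emb y" "\<And>x y. emb (x * y) = emb x * emb y"
    and no_zero_divisors: "\<And>x y :: 'a. x * y = 0 \<Longrightarrow> x = 0 \<or> y = 0"
  shows "unital_subfield {emb a / emb b |a b. a \<in> R \<and> b \<in> R \<and> b \<noteq> 0}" (is "unital_subfield ?K")
proof
  have emb0: "emb 0 = 0" using inj by simp
  have one_ne: "(1::'a) \<noteq> 0" using hom(1) inj[of 1] by auto
  have I: "emb a / emb b \<in> ?K" if "a \<in> R" "b \<in> R" "b \<noteq> 0" for a b using that by blast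
  show "1 \<in> ?K" using I[OF one_closed one_closed one_ne] hom by simp
  fix x assume "x \<in> ?K"
  then obtain a b where x: "x = emb a / emb b" "a \<in> R" "b \<in> R" "b \<noteq> 0" by blast
  show "inverse x \<in> ?K"
  proof (cases "a = 0")
    case True
    then show ?thesis using I[OF zero_closed one_closed one_ne] by (simp add: x emb0)
  next
    case False
    then show ?thesis using I[of b a] x by simp
  qed
  fix y assume "y \<in> ?K"
  then obtain c d where y: "y = emb c / emb d" "c \<in> R" "d \<in> R" "d \<noteq> 0" by blast
  have bd: "b * d \<noteq> 0" using no_zero_divisors x y by blast
  have "x - y = emb (a * d - c * b) / emb (b * d)"
    using x y by (simp add: hom inj diff_frac_eq)
  then show "x - y \<in> ?K" using x y bd by (auto intro!: I mult_closed diff_closed)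
  have "x * y = emb (a * c) / emb (b * d)" using x y by (simp add: hom)
  then show "x * y \<in> ?K" using x y bd by (auto intro!: I mult_closed)
qed

section \<open>Polynomials and rational functions over \<open>Qbar\<close>\<close>

definition Qbar_polys :: "complex poly set" where
  "Qbar_polys = {P. \<forall>i. poly.coeff P i \<in> Qbar}"

interpretation Qbar_polys: unital_subring Qbar_polys
proof
  fix P Q assume PQ: "P \<in> Qbar_polys" "Q \<in> Qbar_polys"
  then show "P - Q \<in> Qbar_polys"
    using Qbar.diff_closed by (simp add: Qbar_polys_def)
  have "poly.coeff P j \<in> Qbar" "poly.coeff Q j \<in> Qbar" for j
    using PQ by (auto simp: Qbar_polys_def)
  then have "poly.coeff (P * Q) i \<in> Qbar" for i
    unfolding coeff_mult by (intro Qbar.sum_closed Qbar.mult_closed)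
  then show "P * Q \<in> Qbar_polys" by (simp add: Qbar_polys_def)
qed (auto simp: Qbar_polys_def coeff_1)

abbreviation fls_of_poly :: "complex poly \<Rightarrow> complex fls" where
  "fls_of_poly P \<equiv> fps_to_fls (fps_of_poly P)"

interpretation Qbar_rf: unital_subfield Qbar_rational_functions
proof -
  have "unital_subfield {fls_of_poly P / fls_of_poly Q |P Q. P \<in> Qbar_polys \<and> Q \<in> Qbar_polys \<and> Q \<noteq> 0}"
    by (rule Qbar_polys.fraction_subfield)
       (auto simp: fps_of_poly_diff fps_of_poly_mult fls_times_fps_to_fls fps_to_fls_eq_0_iff)
  then show "unital_subfield Qbar_rational_functions"
    by (simp add: Qbar_rational_functions_def Qbar_polys_def conj_assoc)
qed

lemma fls_of_poly_in_rf: "P \<in> Qbar_polys \<Longrightarrow> fls_of_poly P \<in> Qbar_rational_functions"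
  unfolding Qbar_rational_functions_def mem_Collect_eq
  by (rule exI[of _ P], rule exI[of _ 1]) (simp add: Qbar_polys_def coeff_1)

text \<open>Differentiating F * Q = P expresses the derivative of F through F and
  polynomials.\<close>

lemma fls_deriv_in_rf:
  assumes "F \<in> Qbar_rational_functions"
  shows "fls_deriv F \<in> Qbar_rational_functions"
proof -
  obtain P Q where PQ: "P \<in> Qbar_polys" "Q \<in> Qbar_polys" "Q \<noteq> 0" "F = fls_of_poly P / fls_of_poly Q"
    using assms by (auto simp: Qbar_rational_functions_def Qbar_polys_def)
  have pderiv: "pderiv A \<in> Qbar_polys" if "A \<in> Qbar_polys" for A
    using that Qbar.mult_closed[OF Qbar.of_nat_closed]
    by (simp add: Qbar_polys_def coeff_pderiv del: of_nat_Suc)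
  have deriv: "fls_deriv (fls_of_poly A) = fls_of_poly (pderiv A)" for A
    by (simp add: fls_deriv_fps_to_fls fps_of_poly_pderiv)
  have Q0: "fls_of_poly Q \<noteq> 0" using PQ by (simp add: fps_to_fls_eq_0_iff)
  then have "fls_deriv (F * fls_of_poly Q) = fls_deriv (fls_of_poly P)" by (simp add: PQ(4))
  then have "fls_deriv F = (fls_of_poly (pderiv P) - F * fls_of_poly (pderiv Q)) / fls_of_poly Q"
    using Q0 by (simp add: deriv field_simps)
  then show ?thesis
    using PQ assms pderiv
    by (metis Qbar_rf.divide_closed Qbar_rf.diff_closed Qbar_rf.mult_closed fls_of_poly_in_rf)
qed

text \<open>By the Leibniz rule, and since coefficients have rational derivatives, stability under
  derivation can be checked on generators.\<close>

lemma fls_deriv_in_lin_span: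
  assumes "\<And>s. s \<in> S \<Longrightarrow> fls_deriv s \<in> Qbar_rf.lin_span S" "x \<in> Qbar_rf.lin_span S"
  shows "fls_deriv x \<in> Qbar_rf.lin_span S"
  using assms(2)
proof (induction rule: Qbar_rf.lin_span.induct)
  case (step r s x)
  have "r * fls_deriv s \<in> Qbar_rf.lin_span S"
    by (rule Qbar_rf.lin_span_scale[OF assms(1)[OF step(2)] step(1)])
  moreover have "fls_deriv r * s \<in> Qbar_rf.lin_span S"
    by (rule Qbar_rf.lin_span_scale[OF Qbar_rf.lin_span_base[OF step(2)] fls_deriv_in_rf[OF step(1)]])
  ultimately have "r * fls_deriv s + fls_deriv r * s + fls_deriv x \<in> Qbar_rf.lin_span S"
    by (intro Qbar_rf.lin_span_add[OF Qbar_rf.lin_span_add] step.IH)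
  then show ?case by simp
qed (simp add: Qbar_rf.lin_span.zero)

text \<open>Membership in a finite-dimensional space over the rational functions that is stable
  under derivation. In this form closure under sums and products is linear algebra;
  \<open>D_finite_iff_differential_equation\<close> links it to differential equations.\<close>

definition D_finite :: "complex fls \<Rightarrow> bool" where
  "D_finite F \<longleftrightarrow> (\<exists>S. finite S \<and> F \<in> Qbar_rf.lin_span S \<and>
     (\<forall>s\<in>S. fls_deriv s \<in> Qbar_rf.lin_span S))"

lemma D_finite_add:
  assumes "D_finite F" "D_finite G"
  shows "D_finite (F + G)"
proof -
  obtain S T where ST: "finite S" "F \<in> Qbar_rf.lin_span S" "\<And>s. s \<in> S \<Longrightarrow> fls_deriv s \<in> Qbar_rf.lin_span S"
    "finite T" "G \<in> Qbar_rf.lin_span T" "\<And>s. s \<in> T \<Longrightarrow> fls_deriv s \<in> Qbar_rf.lin_span T"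
    using assms unfolding D_finite_def by metis
  have mono: "x \<in> Qbar_rf.lin_span (S \<union> T)" if "x \<in> Qbar_rf.lin_span S \<or> x \<in> Qbar_rf.lin_span T" for x
    using that Qbar_rf.lin_span_mono by blast
  show ?thesis
    unfolding D_finite_def using ST(1,4) mono[of F] mono[of G] ST(2,5)
      mono[of "fls_deriv s" for s] ST(3,6) Qbar_rf.lin_span_add[of F "S \<union> T" G]
    by (intro exI[of _ "S \<union> T"]) blast
qed

lemma D_finite_mult:
  assumes "D_finite F" "D_finite G"
  shows "D_finite (F * G)"
proof -
  obtain S T where ST: "finite S" "F \<in> Qbar_rf.lin_span S" "\<And>s. s \<in> S \<Longrightarrow> fls_deriv s \<in> Qbar_rf.lin_span S"
    "finite T" "G \<in> Qbar_rf.lin_span T" "\<And>s. s \<in> T \<Longrightarrow> fls_deriv s \<in> Qbar_rf.lin_span T"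
    using assms unfolding D_finite_def by metis
  define U where "U = {s * t |s t. s \<in> S \<and> t \<in> T}"
  have "U = (\<lambda>(s, t). s * t) ` (S \<times> T)" by (auto simp: U_def)
  then have "finite U" using ST by simp
  moreover have "F * G \<in> Qbar_rf.lin_span U"
    unfolding U_def by (intro Qbar_rf.lin_span_mult ST)
  moreover have "fls_deriv u \<in> Qbar_rf.lin_span U" if u: "u \<in> U" for u
  proof -
    obtain s t where st: "u = s * t" "s \<in> S" "t \<in> T" using u by (auto simp: U_def)
    then have "s * fls_deriv t + fls_deriv s * t \<in> Qbar_rf.lin_span U"
      unfolding U_def by (intro Qbar_rf.lin_span_add Qbar_rf.lin_span_mult Qbar_rf.lin_span_base ST)
    then show ?thesis by (simp add: st)
  qed
  ultimately show ?thesis unfolding D_finite_def by blast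
qed

lemma D_finite_rf: "F \<in> Qbar_rational_functions \<Longrightarrow> D_finite F"
  unfolding D_finite_def
  using Qbar_rf.lin_span_scale[OF Qbar_rf.lin_span_base, of 1 "{1}" F]
  by (intro exI[of _ "{1}"]) (auto intro: Qbar_rf.lin_span.zero)

lemma D_finite_exp:
  assumes "\<alpha> \<in> Qbar"
  shows "D_finite (fps_to_fls (fps_exp \<alpha>))"
proof -
  have "fls_of_poly [:\<alpha>:] * fps_to_fls (fps_exp \<alpha>) \<in> Qbar_rf.lin_span {fps_to_fls (fps_exp \<alpha>)}"
    using assms by (intro Qbar_rf.lin_span_scale Qbar_rf.lin_span_base fls_of_poly_in_rf)
      (auto simp: Qbar_polys_def coeff_pCons split: nat.splits)
  then show ?thesis
    unfolding D_finite_def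
    by (intro exI[of _ "{fps_to_fls (fps_exp \<alpha>)}"])
       (auto simp: fls_deriv_fps_to_fls fls_times_fps_to_fls fps_of_poly_pCons
          intro: Qbar_rf.lin_span_base)
qed

text \<open>Forwards, the first \<open>card S + 1\<close> derivatives lie in a span of
  \<open>card S\<close> elements and are therefore dependent. Backwards, the equation is solved for
  its highest derivative, and the lower ones span a stable space.\<close>

lemma D_finite_iff_differential_equation:
  "D_finite (fps_to_fls f) \<longleftrightarrow>
     (\<exists>m c. (\<forall>i\<le>m. c i \<in> Qbar_rational_functions) \<and> (\<exists>i\<le>m. c i \<noteq> 0) \<and>
        (\<Sum>i\<le>m. c i * fps_to_fls ((fps_deriv ^^ i) f)) = 0)"
  (is "?L \<longleftrightarrow> ?R")
proof
  assume ?L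
  then obtain S where S: "finite S" "fps_to_fls f \<in> Qbar_rf.lin_span S"
    "\<And>s. s \<in> S \<Longrightarrow> fls_deriv s \<in> Qbar_rf.lin_span S"
    unfolding D_finite_def by blast
  have "fps_to_fls ((fps_deriv ^^ i) f) \<in> Qbar_rf.lin_span S" for i
  proof (induction i)
    case (Suc i)
    then show ?case using fls_deriv_in_lin_span[OF S(3) Suc.IH] by (simp add: fls_deriv_fps_to_fls)
  qed (simp add: S)
  then have "\<exists>c. (\<forall>i. c i \<in> Qbar_rational_functions) \<and> (\<exists>i\<in>{..card S}. c i \<noteq> 0) \<and>
      (\<Sum>i\<in>{..card S}. c i * fps_to_fls ((fps_deriv ^^ i) f)) = 0"
    by (intro Qbar_rf.linear_dependence[OF S(1)]) auto
  then obtain c where "\<forall>i. c i \<in> Qbar_rational_functions" "\<exists>i\<le>card S. c i \<noteq> 0"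
    "(\<Sum>i\<le>card S. c i * fps_to_fls ((fps_deriv ^^ i) f)) = 0" by auto
  then show ?R by (intro exI[of _ "card S"] exI[of _ c]) auto
next
  assume ?R
  then obtain m c where c: "\<And>i. i \<le> m \<Longrightarrow> c i \<in> Qbar_rational_functions" "\<exists>i\<le>m. c i \<noteq> 0"
    "(\<Sum>i\<le>m. c i * fps_to_fls ((fps_deriv ^^ i) f)) = 0" by blast
  define F where "F = (\<lambda>i. fps_to_fls ((fps_deriv ^^ i) f))"
  \<comment> \<open>The true order of the equation, as \<open>c m\<close> may vanish. If it is 0,
    then f = 0 and the set \<open>S\<close> below is empty.\<close>
  define M where "M = Max {i. i \<le> m \<and> c i \<noteq> 0}"
  have fin: "finite {i. i \<le> m \<and> c i \<noteq> 0}" by simp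
  have M: "M \<le> m" "c M \<noteq> 0" using Max_in[OF fin] c(2) by (auto simp: M_def)
  have above: "c i = 0" if "M < i" "i \<le> m" for i
    using Max_ge[OF fin, of i] that by (fastforce simp: M_def)
  have "0 = (\<Sum>i\<le>m. c i * F i)" using c by (simp add: F_def)
  also have "\<dots> = (\<Sum>i\<le>M. c i * F i)"
    using M above by (intro sum.mono_neutral_right) auto
  also have "\<dots> = c M * F M + (\<Sum>i<M. c i * F i)"
    by (simp add: lessThan_Suc_atMost[symmetric])
  finally have "c M * F M = (\<Sum>i<M. - (c i * F i))"
    by (simp add: sum_negf eq_neg_iff_add_eq_0)
  then have "F M = (\<Sum>i<M. - (c i * F i)) / c M" using M by (simp add: field_simps)
  then have top: "F M = (\<Sum>i<M. (- (c i / c M)) * F i)" by (simp add: sum_divide_distrib)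
  define S where "S = F ` {..<M}"
  have "F M \<in> Qbar_rf.lin_span S"
    unfolding top
  proof (rule Qbar_rf.lin_span_sum, rule Qbar_rf.lin_span_scale)
    fix i assume "i \<in> {..<M}"
    then show "F i \<in> Qbar_rf.lin_span S" "- (c i / c M) \<in> Qbar_rational_functions"
      using M c(1) by (auto simp: S_def intro!: Qbar_rf.lin_span_base Qbar_rf.uminus_closed Qbar_rf.divide_closed)
  qed
  then have "F i \<in> Qbar_rf.lin_span S" if "i \<le> M" for i
    using that by (cases "i = M") (auto simp: S_def intro!: Qbar_rf.lin_span_base)
  moreover have "fls_deriv (F i) = F (Suc i)" for i by (simp add: F_def fls_deriv_fps_to_fls)
  ultimately have "finite S" "F 0 \<in> Qbar_rf.lin_span S" "\<forall>s\<in>S. fls_deriv s \<in> Qbar_rf.lin_span S"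
    by (auto simp: S_def)
  then show ?L unfolding D_finite_def by (auto simp: F_def)
qed

section \<open>The ring of E-functions\<close>

lemma
  assumes "\<sigma> \<in> absolute_Galois_group"
  shows Galois_add: "x \<in> Qbar \<Longrightarrow> y \<in> Qbar \<Longrightarrow> \<sigma> (x + y) = \<sigma> x + \<sigma> y"
    and Galois_mult: "x \<in> Qbar \<Longrightarrow> y \<in> Qbar \<Longrightarrow> \<sigma> (x * y) = \<sigma> x * \<sigma> y"
    and Galois_rat: "q \<in> \<rat> \<Longrightarrow> \<sigma> q = q"
  using assms by (auto simp: absolute_Galois_group_def)

lemma Galois_sum:
  assumes "\<sigma> \<in> absolute_Galois_group" "\<And>i. i \<in> A \<Longrightarrow> f i \<in> Qbar"
  shows "\<sigma> (sum f A) = (\<Sum>i\<in>A. \<sigma> (f i))"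
  using assms(2)
proof (induction A rule: infinite_finite_induct)
  case (insert x A)
  then have "f x \<in> Qbar" "sum f A \<in> Qbar" using Qbar.sum_closed[of A f] by blast+
  then have "\<sigma> (f x + sum f A) = \<sigma> (f x) + \<sigma> (sum f A)" by (rule Galois_add[OF assms(1)])
  then show ?case using insert by simp
qed (use Galois_rat[OF assms(1), of 0] in auto)

lemma Galois_power:
  assumes "\<sigma> \<in> absolute_Galois_group" "x \<in> Qbar"
  shows "\<sigma> (x ^ n) = \<sigma> x ^ n"
proof (induction n)
  case (Suc n)
  have "\<sigma> (x * x ^ n) = \<sigma> x * \<sigma> (x ^ n)"
    by (rule Galois_mult[OF assms Qbar.power_closed[OF assms(2)]])
  then show ?case using Suc by simp
qed (use Galois_rat[OF assms(1), of 1] in auto)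

lemma id_in_Galois: "(\<lambda>x. x) \<in> absolute_Galois_group"
  by (auto simp: absolute_Galois_group_def bij_betw_def)

text \<open>All conjugates are roots of one integer polynomial, which has finitely many. The summand
  1 in the bound makes it positive.\<close>

lemma conjugates_bounded:
  assumes "x \<in> Qbar"
  obtains B where "B > 0" "\<And>\<sigma>. \<sigma> \<in> absolute_Galois_group \<Longrightarrow> norm (\<sigma> x) \<le> B"
proof -
  obtain p where p: "\<And>i. poly.coeff p i \<in> \<int>" "p \<noteq> 0" "poly p x = 0"
    using assms unfolding algebraic_def by blast
  have rat: "poly.coeff p i \<in> \<rat>" for i using p(1)[of i] Ints_subset_Rats by blast
  then have alg: "poly.coeff p i \<in> Qbar" for i by (simp add: rat_imp_algebraic)
  have root: "\<sigma> x \<in> {z. poly p z = 0}" if \<sigma>: "\<sigma> \<in> absolute_Galois_group" for \<sigma>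
  proof -
    have "0 = \<sigma> (poly p x)" using p(3) Galois_rat[OF \<sigma>, of 0] by simp
    also have "\<dots> = (\<Sum>i\<le>Polynomial.degree p. \<sigma> (poly.coeff p i * x ^ i))"
      unfolding poly_altdef
      by (rule Galois_sum[OF \<sigma>]) (intro Qbar.mult_closed Qbar.power_closed alg assms)
    also have "\<dots> = (\<Sum>i\<le>Polynomial.degree p. poly.coeff p i * \<sigma> x ^ i)"
    proof (rule sum.cong)
      fix i
      have "\<sigma> (poly.coeff p i * x ^ i) = \<sigma> (poly.coeff p i) * \<sigma> (x ^ i)"
        by (intro Galois_mult[OF \<sigma>] Qbar.power_closed alg assms)
      then show "\<sigma> (poly.coeff p i * x ^ i) = poly.coeff p i * \<sigma> x ^ i"
        by (simp add: Galois_power[OF \<sigma> assms] Galois_rat[OF \<sigma> rat])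
    qed simp
    finally show ?thesis by (simp add: poly_altdef)
  qed
  have fin: "finite (norm ` {z. poly p z = 0})" using p(2) by (simp add: poly_roots_finite)
  show ?thesis
  proof
    show "1 + (\<Sum>r\<in>norm ` {z. poly p z = 0}. r) > 0"
      by (intro add_pos_nonneg sum_nonneg) auto
    fix \<sigma> assume "\<sigma> \<in> absolute_Galois_group"
    then have "norm (\<sigma> x) \<in> norm ` {z. poly p z = 0}" using root by blast
    then have "norm (\<sigma> x) \<le> (\<Sum>r\<in>norm ` {z. poly p z = 0}. r)"
      by (rule member_le_sum) (use fin in auto)
    then show "norm (\<sigma> x) \<le> 1 + (\<Sum>r\<in>norm ` {z. poly p z = 0}. r)" by simp
  qed
qed

text \<open>The shape A * B^n, in place of C^(n+1), passes directly through sums and products;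
  \<open>E_functions_iff\<close> shows that both shapes define the same functions.\<close>

definition conjugates_exp_bounded :: "(nat \<Rightarrow> complex) \<Rightarrow> bool" where
  "conjugates_exp_bounded a \<longleftrightarrow> (\<exists>A>0. \<exists>B>0. \<forall>n. \<forall>\<sigma>\<in>absolute_Galois_group. norm (\<sigma> (a n)) \<le> A * B ^ n)"

definition denominators_exp_bounded :: "(nat \<Rightarrow> complex) \<Rightarrow> bool" where
  "denominators_exp_bounded a \<longleftrightarrow> (\<exists>A>0. \<exists>B>0. \<exists>d::nat \<Rightarrow> nat. \<forall>n. d n > 0 \<and> real (d n) \<le> A * B ^ n \<and>
     (\<forall>m\<le>n. algebraic_int (of_nat (d n) * a m)))"

lemma conjugates_exp_boundedI:
  "A > 0 \<Longrightarrow> B > 0 \<Longrightarrow> (\<And>n \<sigma>. \<sigma> \<in> absolute_Galois_group \<Longrightarrow> norm (\<sigma> (a n)) \<le> A * B ^ n) \<Longrightarrow>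
   conjugates_exp_bounded a"
  unfolding conjugates_exp_bounded_def by blast

lemma denominators_exp_boundedI:
  fixes d :: "nat \<Rightarrow> nat"
  assumes "A > 0" "B > 0" "\<And>n. d n > 0" "\<And>n. real (d n) \<le> A * B ^ n"
    "\<And>n m. m \<le> n \<Longrightarrow> algebraic_int (of_nat (d n) * a m)"
  shows "denominators_exp_bounded a"
  unfolding denominators_exp_bounded_def
  using assms by (intro exI[of _ A] exI[of _ B] exI[of _ d] conjI allI impI)

definition egf_coeff :: "complex fps \<Rightarrow> nat \<Rightarrow> complex" where
  "egf_coeff f n = fact n * fps_nth f n"

text \<open>The maxima with 1 allow constants below 1: a base of at least 1 dominates
  \<open>A\<close> by its (n+1)-th power and absorbs the extra factor.\<close>

lemma geometric_bound_le_power_Suc: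
  fixes A B :: real
  assumes "A > 0" "B > 0"
  shows "A * B ^ n \<le> (max 1 A * max 1 B) ^ (n + 1)"
proof -
  have "A \<le> max 1 A ^ (n + 1)" using self_le_power[of "max 1 A" "n + 1"] by simp
  moreover have "B ^ n \<le> max 1 B ^ n" using assms by (intro power_mono) auto
  then have "B ^ n \<le> max 1 B ^ (n + 1)"
    using power_increasing[of n "n + 1" "max 1 B"] by linarith
  ultimately show ?thesis unfolding power_mult_distrib using assms by (intro mult_mono) auto
qed

lemma E_functions_iff:
  "f \<in> E_functions \<longleftrightarrow> (\<forall>n. egf_coeff f n \<in> Qbar) \<and> D_finite (fps_to_fls f) \<and>
     conjugates_exp_bounded (egf_coeff f) \<and> denominators_exp_bounded (egf_coeff f)"
proof -
  have 1: "(\<exists>C>0. \<forall>n. \<forall>z\<in>Galois_conjugates (a n). norm z \<le> C ^ (n + 1)) \<longleftrightarrow> conjugates_exp_bounded a"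
    (is "?L \<longleftrightarrow> _") for a
  proof
    assume ?L
    then obtain C where "C > 0" "\<And>n \<sigma>. \<sigma> \<in> absolute_Galois_group \<Longrightarrow> norm (\<sigma> (a n)) \<le> C * C ^ n"
      by (auto simp: Galois_conjugates_def)
    then show "conjugates_exp_bounded a" by (intro conjugates_exp_boundedI)
  next
    assume "conjugates_exp_bounded a"
    then obtain A B where AB: "A > 0" "B > 0"
      "\<And>n \<sigma>. \<sigma> \<in> absolute_Galois_group \<Longrightarrow> norm (\<sigma> (a n)) \<le> A * B ^ n"
      unfolding conjugates_exp_bounded_def by blast
    show ?L
      using AB geometric_bound_le_power_Suc[OF AB(1,2)]
      by (intro exI[of _ "max 1 A * max 1 B"])
         (auto simp: Galois_conjugates_def simp del: power_Suc intro: order_trans mult_pos_pos)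
  qed
  have 2: "(\<exists>C (d :: nat \<Rightarrow> nat). C > 0 \<and> (\<forall>n. d n > 0 \<and> real (d n) \<le> C ^ (n + 1) \<and>
      (\<forall>m\<le>n. algebraic_int (of_nat (d n) * a m)))) \<longleftrightarrow> denominators_exp_bounded a"
    (is "?L \<longleftrightarrow> _") for a
  proof
    assume ?L
    then obtain C and d :: "nat \<Rightarrow> nat" where "C > 0" "\<forall>n. d n > 0 \<and> real (d n) \<le> C * C ^ n \<and>
      (\<forall>m\<le>n. algebraic_int (of_nat (d n) * a m))"
      by auto
    then show "denominators_exp_bounded a" by (intro denominators_exp_boundedI[of C C d]) auto
  next
    assume "denominators_exp_bounded a"
    then obtain A B and d :: "nat \<Rightarrow> nat" where AB: "A > 0" "B > 0"
      "\<And>n. d n > 0" "\<And>n. real (d n) \<le> A * B ^ n"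
      "\<And>n m. m \<le> n \<Longrightarrow> algebraic_int (of_nat (d n) * a m)"
      unfolding denominators_exp_bounded_def by blast
    have "real (d n) \<le> (max 1 A * max 1 B) ^ (n + 1)" for n
      using AB(4) geometric_bound_le_power_Suc[OF AB(1,2)] by (rule order_trans)
    moreover have "max 1 A * max 1 B > 0" by simp
    ultimately show ?L using AB(3,5) by blast
  qed
  show ?thesis
    unfolding E_functions_def egf_coeff_def[abs_def] Let_def mem_Collect_eq[of f] 1 2
      D_finite_iff_differential_equation by simp
qed

section \<open>Closure properties of the E-functions\<close>

lemma egf_coeff_add: "egf_coeff (f + g) n = egf_coeff f n + egf_coeff g n"
  by (simp add: egf_coeff_def algebra_simps)

lemma egf_coeff_mult:
  "egf_coeff (f * g) n = (\<Sum>k\<le>n. of_nat (n choose k) * (egf_coeff f k * egf_coeff g (n - k)))"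
  unfolding egf_coeff_def fps_mult_nth sum_distrib_left atLeast0AtMost
  by (intro sum.cong) (auto simp: binomial_fact)

lemma egf_coeff_exp: "egf_coeff (fps_exp \<alpha>) n = \<alpha> ^ n"
  by (simp add: egf_coeff_def)

lemma E_functions_add:
  assumes f: "f \<in> E_functions" and g: "g \<in> E_functions"
  shows "f + g \<in> E_functions"
proof -
  have Q: "egf_coeff f n \<in> Qbar" "egf_coeff g n \<in> Qbar" for n
    using f g by (simp_all add: E_functions_iff)
  obtain A B A' B' where
    AB: "A > 0" "B > 0" "\<And>n \<sigma>. \<sigma> \<in> absolute_Galois_group \<Longrightarrow> norm (\<sigma> (egf_coeff f n)) \<le> A * B ^ n"
    and AB': "A' > 0" "B' > 0" "\<And>n \<sigma>. \<sigma> \<in> absolute_Galois_group \<Longrightarrow> norm (\<sigma> (egf_coeff g n)) \<le> A' * B' ^ n"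
    using f g unfolding E_functions_iff conjugates_exp_bounded_def by metis
  have "norm (\<sigma> (egf_coeff (f + g) n)) \<le> (A + A') * (max B B') ^ n"
    if \<sigma>: "\<sigma> \<in> absolute_Galois_group" for \<sigma> n
  proof -
    have "\<sigma> (egf_coeff (f + g) n) = \<sigma> (egf_coeff f n) + \<sigma> (egf_coeff g n)"
      unfolding egf_coeff_add by (rule Galois_add[OF \<sigma> Q])
    then have "norm (\<sigma> (egf_coeff (f + g) n)) \<le> A * B ^ n + A' * B' ^ n"
      using norm_triangle_le[OF add_mono[OF AB(3)[OF \<sigma>] AB'(3)[OF \<sigma>]]] by simp
    also have "\<dots> \<le> A * (max B B') ^ n + A' * (max B B') ^ n"
      using AB AB' by (intro add_mono mult_left_mono power_mono) auto
    finally show ?thesis by (simp add: distrib_right)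
  qed
  moreover have "A + A' > 0" "max B B' > 0" using AB AB' by auto
  ultimately have conj: "conjugates_exp_bounded (egf_coeff (f + g))"
    by (intro conjugates_exp_boundedI)
  obtain A B d A' B' d' where
    AB: "A > 0" "B > 0" "\<And>n. d n > (0::nat)" "\<And>n. real (d n) \<le> A * B ^ n"
      "\<And>n m. m \<le> n \<Longrightarrow> algebraic_int (of_nat (d n) * egf_coeff f m)"
    and AB': "A' > 0" "B' > 0" "\<And>n. d' n > (0::nat)" "\<And>n. real (d' n) \<le> A' * B' ^ n"
      "\<And>n m. m \<le> n \<Longrightarrow> algebraic_int (of_nat (d' n) * egf_coeff g m)"
    using f g unfolding E_functions_iff denominators_exp_bounded_def by metis
  have "d n * d' n > 0" for n using AB AB' by simp
  moreover have "real (d n * d' n) \<le> (A * A') * (B * B') ^ n" for n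
  proof -
    have "real (d n) * real (d' n) \<le> (A * B ^ n) * (A' * B' ^ n)"
      using AB AB' by (intro mult_mono) auto
    then show ?thesis by (simp add: power_mult_distrib mult_ac)
  qed
  moreover have "algebraic_int (of_nat (d n * d' n) * egf_coeff (f + g) m)" if "m \<le> n" for n m
  proof -
    have "of_nat (d n * d' n) * egf_coeff (f + g) m
        = of_nat (d' n) * (of_nat (d n) * egf_coeff f m) + of_nat (d n) * (of_nat (d' n) * egf_coeff g m)"
      by (simp add: egf_coeff_add algebra_simps)
    also have "algebraic_int \<dots>"
      by (rule algebraic_int_add; rule algebraic_int_mult[OF algebraic_int_of_nat])
         (use AB(5) AB'(5) that in blast)+
    finally show ?thesis .
  qed
  moreover have "A * A' > 0" "B * B' > 0" using AB AB' by auto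
  ultimately have denom: "denominators_exp_bounded (egf_coeff (f + g))"
    by (intro denominators_exp_boundedI[where d = "\<lambda>n. d n * d' n"])
  have "D_finite (fps_to_fls (f + g))"
    using f g D_finite_add by (simp add: E_functions_iff fps_to_fls_plus)
  moreover have "egf_coeff (f + g) n \<in> Qbar" for n
    unfolding egf_coeff_add by (intro Qbar.add_closed Q)
  ultimately show ?thesis using conj denom by (simp add: E_functions_iff)
qed

text \<open>The coefficients of a product are a binomial convolution. Its weights are integers, so
  denominators simply multiply, and the binomial theorem sums the bounds to A A' (B + B')^n.\<close>

lemma E_functions_mult:
  assumes f: "f \<in> E_functions" and g: "g \<in> E_functions"
  shows "f * g \<in> E_functions"
proof -
  have Q: "egf_coeff f n \<in> Qbar" "egf_coeff g n \<in> Qbar" for n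
    using f g by (simp_all add: E_functions_iff)
  have Q': "of_nat k * (egf_coeff f i * egf_coeff g j) \<in> Qbar" for i j k
    by (intro Qbar.mult_closed Qbar.of_nat_closed Q)
  obtain A B A' B' where
    AB: "A > 0" "B > 0" "\<And>n \<sigma>. \<sigma> \<in> absolute_Galois_group \<Longrightarrow> norm (\<sigma> (egf_coeff f n)) \<le> A * B ^ n"
    and AB': "A' > 0" "B' > 0" "\<And>n \<sigma>. \<sigma> \<in> absolute_Galois_group \<Longrightarrow> norm (\<sigma> (egf_coeff g n)) \<le> A' * B' ^ n"
    using f g unfolding E_functions_iff conjugates_exp_bounded_def by metis
  have "norm (\<sigma> (egf_coeff (f * g) n)) \<le> (A * A') * (B + B') ^ n"
    if \<sigma>: "\<sigma> \<in> absolute_Galois_group" for \<sigma> n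
  proof -
    have "\<sigma> (of_nat k * (egf_coeff f i * egf_coeff g j)) = of_nat k * (\<sigma> (egf_coeff f i) * \<sigma> (egf_coeff g j))"
      for i j k
      using Galois_mult[OF \<sigma> Qbar.of_nat_closed Qbar.mult_closed[OF Q], of k i j]
        Galois_mult[OF \<sigma> Q, of i j] Galois_rat[OF \<sigma>, of "of_nat k"] by simp
    then have "\<sigma> (egf_coeff (f * g) n)
        = (\<Sum>k\<le>n. of_nat (n choose k) * (\<sigma> (egf_coeff f k) * \<sigma> (egf_coeff g (n - k))))"
      unfolding egf_coeff_mult by (simp only: Galois_sum[OF \<sigma> Q'])
    also have "norm \<dots> \<le> (\<Sum>k\<le>n. real (n choose k) * ((A * B ^ k) * (A' * B' ^ (n - k))))"
    proof (rule sum_norm_le)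
      fix k
      show "norm (of_nat (n choose k) * (\<sigma> (egf_coeff f k) * \<sigma> (egf_coeff g (n - k))))
          \<le> real (n choose k) * ((A * B ^ k) * (A' * B' ^ (n - k)))"
        unfolding norm_mult norm_of_nat
        using AB AB' \<sigma> by (intro mult_left_mono mult_mono) auto
    qed
    also have "\<dots> = (A * A') * (B + B') ^ n"
      unfolding binomial_ring sum_distrib_left by (intro sum.cong) (auto simp: mult_ac)
    finally show ?thesis .
  qed
  moreover have "A * A' > 0" "B + B' > 0" using AB AB' by auto
  ultimately have conj: "conjugates_exp_bounded (egf_coeff (f * g))"
    by (intro conjugates_exp_boundedI)
  obtain A B d A' B' d' where
    AB: "A > 0" "B > 0" "\<And>n. d n > (0::nat)" "\<And>n. real (d n) \<le> A * B ^ n"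
      "\<And>n m. m \<le> n \<Longrightarrow> algebraic_int (of_nat (d n) * egf_coeff f m)"
    and AB': "A' > 0" "B' > 0" "\<And>n. d' n > (0::nat)" "\<And>n. real (d' n) \<le> A' * B' ^ n"
      "\<And>n m. m \<le> n \<Longrightarrow> algebraic_int (of_nat (d' n) * egf_coeff g m)"
    using f g unfolding E_functions_iff denominators_exp_bounded_def by metis
  have "d n * d' n > 0" for n using AB AB' by simp
  moreover have "real (d n * d' n) \<le> (A * A') * (B * B') ^ n" for n
  proof -
    have "real (d n) * real (d' n) \<le> (A * B ^ n) * (A' * B' ^ n)"
      using AB AB' by (intro mult_mono) auto
    then show ?thesis by (simp add: power_mult_distrib mult_ac)
  qed
  moreover have "algebraic_int (of_nat (d n * d' n) * egf_coeff (f * g) m)" if "m \<le> n" for n m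
  proof -
    have "of_nat (d n * d' n) * egf_coeff (f * g) m
        = (\<Sum>k\<le>m. of_nat (m choose k) * ((of_nat (d n) * egf_coeff f k) * (of_nat (d' n) * egf_coeff g (m - k))))"
      unfolding egf_coeff_mult sum_distrib_left by (intro sum.cong) (auto simp: mult_ac)
    also have "algebraic_int \<dots>"
    proof (rule algebraic_int_sum)
      fix k assume "k \<in> {..m}"
      then have "k \<le> n" "m - k \<le> n" using that by auto
      then show "algebraic_int (of_nat (m choose k) *
          ((of_nat (d n) * egf_coeff f k) * (of_nat (d' n) * egf_coeff g (m - k))))"
        using algebraic_int_mult[OF algebraic_int_of_nat algebraic_int_mult[OF AB(5) AB'(5)]] by blast
    qed
    finally show ?thesis .
  qed
  moreover have "A * A' > 0" "B * B' > 0" using AB AB' by auto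
  ultimately have denom: "denominators_exp_bounded (egf_coeff (f * g))"
    by (intro denominators_exp_boundedI[where d = "\<lambda>n. d n * d' n"])
  have "D_finite (fps_to_fls (f * g))"
    using f g D_finite_mult by (simp add: E_functions_iff fls_times_fps_to_fls)
  moreover have "egf_coeff (f * g) n \<in> Qbar" for n
    unfolding egf_coeff_mult by (intro Qbar.sum_closed Q')
  ultimately show ?thesis using conj denom by (simp add: E_functions_iff)
qed

text \<open>The coefficients are the powers of \<alpha>, so a bound for its conjugates and a
  denominator of \<alpha> yield geometric bounds.\<close>

lemma E_functions_exp:
  assumes \<alpha>: "\<alpha> \<in> Qbar"
  shows "fps_exp \<alpha> \<in> E_functions"
proof -
  obtain B where B: "B > 0" "\<And>\<sigma>. \<sigma> \<in> absolute_Galois_group \<Longrightarrow> norm (\<sigma> \<alpha>) \<le> B"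
    using conjugates_bounded[OF \<alpha>] by blast
  have "norm (\<sigma> (\<alpha> ^ n)) \<le> 1 * B ^ n" if "\<sigma> \<in> absolute_Galois_group" for \<sigma> n
    using B(2)[OF that] by (simp add: Galois_power[OF that \<alpha>] norm_power power_mono)
  then have conj: "conjugates_exp_bounded (egf_coeff (fps_exp \<alpha>))"
    using B(1) by (intro conjugates_exp_boundedI[of 1 B]) (auto simp: egf_coeff_exp)
  obtain d :: nat where d: "d > 0" "algebraic_int (of_nat d * \<alpha>)"
    using algebraic_int_multiple \<alpha> by blast
  have "algebraic_int (of_nat (d ^ n) * \<alpha> ^ m)" if "m \<le> n" for n m
  proof -
    have "(of_nat (d ^ n) :: complex) = of_nat (d ^ (n - m)) * of_nat d ^ m"
      using that by (simp flip: power_add)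
    then have "of_nat (d ^ n) * \<alpha> ^ m = of_nat (d ^ (n - m)) * (of_nat d * \<alpha>) ^ m"
      by (simp only: power_mult_distrib mult.assoc)
    also have "algebraic_int \<dots>"
      by (intro algebraic_int_mult[OF algebraic_int_of_nat] algebraic_int_power d)
    finally show ?thesis .
  qed
  moreover have "real (d ^ n) \<le> 1 * real d ^ n" "d ^ n > 0" for n using d by auto
  moreover have "real d > 0" using d by simp
  ultimately have denom: "denominators_exp_bounded (egf_coeff (fps_exp \<alpha>))"
    by (intro denominators_exp_boundedI[of 1 "real d" "\<lambda>n. d ^ n"]) (auto simp: egf_coeff_exp)
  have "\<alpha> ^ n \<in> Qbar" for n using Qbar.power_closed[OF \<alpha>] .
  then show ?thesis using conj denom D_finite_exp[OF \<alpha>] by (simp add: E_functions_iff egf_coeff_exp)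
qed

lemma E_functions_const:
  assumes c: "c \<in> Qbar"
  shows "fps_const c \<in> E_functions"
proof -
  have egf: "egf_coeff (fps_const c) n = (if n = 0 then c else 0)" for n
    by (simp add: egf_coeff_def)
  obtain B where B: "B > 0" "\<And>\<sigma>. \<sigma> \<in> absolute_Galois_group \<Longrightarrow> norm (\<sigma> c) \<le> B"
    using conjugates_bounded[OF c] by blast
  then have "norm (\<sigma> (egf_coeff (fps_const c) n)) \<le> B * 1 ^ n" if "\<sigma> \<in> absolute_Galois_group" for \<sigma> n
    using that Galois_rat[OF that, of 0] by (simp add: egf)
  then have conj: "conjugates_exp_bounded (egf_coeff (fps_const c))"
    using B(1) by (intro conjugates_exp_boundedI[of B 1]) auto
  obtain d :: nat where d: "d > 0" "algebraic_int (of_nat d * c)"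
    using algebraic_int_multiple c by blast
  then have "denominators_exp_bounded (egf_coeff (fps_const c))"
    by (intro denominators_exp_boundedI[of "real d" 1 "\<lambda>_. d"]) (auto simp: egf)
  moreover have "D_finite (fps_to_fls (fps_const c))"
    using c fls_of_poly_in_rf[of "[:c:]"] D_finite_rf
    by (simp add: Qbar_polys_def coeff_pCons fps_of_poly_pCons split: nat.splits)
  ultimately show ?thesis using conj c by (simp add: E_functions_iff egf)
qed

lemma E_functions_sum:
  "(\<And>i. i \<in> A \<Longrightarrow> f i \<in> E_functions) \<Longrightarrow> sum f A \<in> E_functions"
  using E_functions_const[of 0]
  by (induction A rule: infinite_finite_induct) (auto intro: E_functions_add)

lemma E_functions_prod_list:
  "(\<And>f. f \<in> set fs \<Longrightarrow> f \<in> E_functions) \<Longrightarrow> prod_list fs \<in> E_functions"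
  using E_functions_const[of 1]
  by (induction fs) (auto intro: E_functions_mult)

lemma E_functions_power: "f \<in> E_functions \<Longrightarrow> f ^ n \<in> E_functions"
  using E_functions_const[of 1] by (induction n) (auto intro: E_functions_mult)

text \<open>
  Dividing by \<open>X\<close> replaces \<open>a\<^sub>n\<close> by \<open>a\<^sub>n\<^sub>+\<^sub>1 / (n + 1)\<close>, so the denominators grow by a common multiple
  of \<open>1, \<dots>, n + 1\<close>.
\<close>
lemma E_functions_divide_X:
  assumes f: "fps_X * f \<in> E_functions"
  shows "f \<in> E_functions"
proof -
  have egf: "egf_coeff f n = egf_coeff (fps_X * f) (Suc n) / of_nat (Suc n)" for n
    by (simp add: egf_coeff_def del: of_nat_Suc)
  have Q: "egf_coeff (fps_X * f) n \<in> Qbar" for n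
    using f by (simp add: E_functions_iff)
  then have Qf: "egf_coeff f n \<in> Qbar" for n
    using algebraic_divide[OF _ algebraic_of_nat, of "egf_coeff (fps_X * f) (Suc n)" "Suc n"]
    by (simp add: egf del: of_nat_Suc)
  obtain A B where
    AB: "A > 0" "B > 0" "\<And>n \<sigma>. \<sigma> \<in> absolute_Galois_group \<Longrightarrow> norm (\<sigma> (egf_coeff (fps_X * f) n)) \<le> A * B ^ n"
    using f unfolding E_functions_iff conjugates_exp_bounded_def by metis
  have "norm (\<sigma> (egf_coeff f n)) \<le> (A * B) * B ^ n"
    if \<sigma>: "\<sigma> \<in> absolute_Galois_group" for \<sigma> n
  proof -
    have "egf_coeff (fps_X * f) (Suc n) = of_nat (Suc n) * egf_coeff f n"
      by (simp add: egf del: of_nat_Suc)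
    then have "\<sigma> (egf_coeff (fps_X * f) (Suc n)) = of_nat (Suc n) * \<sigma> (egf_coeff f n)"
      using Galois_mult[OF \<sigma> Qbar.of_nat_closed Qf, of "Suc n" n] Galois_rat[OF \<sigma>, of "of_nat (Suc n)"]
      by (simp del: of_nat_Suc)
    then have "of_nat (Suc n) * norm (\<sigma> (egf_coeff f n)) \<le> A * B ^ Suc n"
      using AB(3)[OF \<sigma>, of "Suc n"] by (simp add: norm_mult del: of_nat_Suc power_Suc)
    moreover have "norm (\<sigma> (egf_coeff f n)) \<le> of_nat (Suc n) * norm (\<sigma> (egf_coeff f n))"
      by (simp add: distrib_right)
    ultimately show ?thesis by simp
  qed
  moreover have "A * B > 0" using AB by simp
  ultimately have conj: "conjugates_exp_bounded (egf_coeff f)"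
    using AB(2) by (intro conjugates_exp_boundedI)
  obtain A B d where
    AB: "A > 0" "B > 0" "\<And>n. d n > (0::nat)" "\<And>n. real (d n) \<le> A * B ^ n"
      "\<And>n m. m \<le> n \<Longrightarrow> algebraic_int (of_nat (d n) * egf_coeff (fps_X * f) m)"
    using f unfolding E_functions_iff denominators_exp_bounded_def by metis
  obtain l where l: "\<And>n. l n > (0::nat)" "\<And>n. l n \<le> 16 ^ n"
    "\<And>n m. 1 \<le> m \<Longrightarrow> m \<le> n \<Longrightarrow> m dvd l n"
    using exponential_common_multiple by metis
  \<comment> \<open>Both factors are taken at \<open>Suc n\<close>, since the coefficient
    \<open>m\<close> of \<open>f\<close> comes from the coefficient \<open>m + 1\<close> of
    \<open>fps_X * f\<close> divided by m + 1.\<close>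
  define d' where "d' = (\<lambda>n. d (Suc n) * l (Suc n))"
  have "d' n > 0" for n using AB l by (simp add: d'_def)
  moreover have "real (d' n) \<le> (16 * A * B) * (16 * B) ^ n" for n
  proof -
    have "real (l (Suc n)) \<le> 16 ^ Suc n"
      using l(2)[of "Suc n"] of_nat_mono[of "l (Suc n)" "16 ^ Suc n", where ?'a = real] by simp
    then have "real (d (Suc n)) * real (l (Suc n)) \<le> (A * B ^ Suc n) * 16 ^ Suc n"
      using AB(1,2) AB(4)[of "Suc n"] by (intro mult_mono) auto
    then show ?thesis by (simp add: d'_def power_mult_distrib mult_ac)
  qed
  moreover have "algebraic_int (of_nat (d' n) * egf_coeff f m)" if "m \<le> n" for n m
  proof -
    have "Suc m dvd l (Suc n)" using l(3)[of "Suc m" "Suc n"] that by simp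
    then obtain k where k: "l (Suc n) = Suc m * k" by (rule dvdE)
    have "of_nat (d' n) * egf_coeff f m
        = of_nat k * (of_nat (d (Suc n)) * egf_coeff (fps_X * f) (Suc m))"
      by (simp add: d'_def k egf del: of_nat_Suc mult_Suc)
    also have "algebraic_int \<dots>"
      using algebraic_int_mult[OF algebraic_int_of_nat AB(5)] that by auto
    finally show ?thesis .
  qed
  moreover have "16 * A * B > 0" "16 * B > 0" using AB by auto
  ultimately have denom: "denominators_exp_bounded (egf_coeff f)"
    by (intro denominators_exp_boundedI[where d = d'])
  have X: "fls_of_poly [:0, 1:] = fls_X"
    by (simp add: fps_of_poly_pCons)
  have "inverse fls_X \<in> Qbar_rational_functions"
    unfolding X[symmetric]
    by (intro Qbar_rf.inverse_closed fls_of_poly_in_rf) (auto simp: Qbar_polys_def coeff_pCons split: nat.splits)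
  then have "D_finite (inverse fls_X * fps_to_fls (fps_X * f))"
    using f D_finite_rf by (intro D_finite_mult) (auto simp: E_functions_iff)
  moreover have "inverse fls_X * fps_to_fls (fps_X * f) = fps_to_fls f"
    by (simp only: fls_times_fps_to_fls fps_X_to_fls mult.assoc[symmetric]) simp
  ultimately show ?thesis using conj denom Qf by (simp add: E_functions_iff)
qed

lemma E_functions_divide_X_power: "fps_X ^ k * f \<in> E_functions \<Longrightarrow> f \<in> E_functions"
  by (induction k) (auto simp: mult.assoc dest: E_functions_divide_X)

text \<open>The identity is a Galois automorphism, so the coefficients themselves are bounded by A *
  B^n, and the exponential series is a majorant.\<close>

lemma fps_conv_radius_E_functions:
  assumes "f \<in> E_functions"
  shows "fps_conv_radius f = \<infinity>"
proof -
  obtain A B where AB: "A > 0" "B > 0" "\<And>n. norm (egf_coeff f n) \<le> A * B ^ n"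
    using assms id_in_Galois unfolding E_functions_iff conjugates_exp_bounded_def by metis
  have "summable (\<lambda>n. fps_nth f n * z ^ n)" for z
  proof (rule summable_comparison_test')
    show "summable (\<lambda>n. A * (inverse (fact n) * (B * norm z) ^ n))"
      by (intro summable_mult summable_exp)
    fix n
    have "norm (fps_nth f n) \<le> A * B ^ n / fact n"
      using AB(3)[of n] by (simp add: egf_coeff_def norm_mult field_simps)
    then have "norm (fps_nth f n) * norm z ^ n \<le> A * B ^ n / fact n * norm z ^ n"
      by (rule mult_right_mono) simp
    then show "norm (fps_nth f n * z ^ n) \<le> A * (inverse (fact n) * (B * norm z) ^ n)"
      by (simp add: norm_mult norm_power power_mult_distrib field_simps)
  qed
  then show ?thesis
    unfolding fps_conv_radius_def by (intro conv_radius_inftyI'')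
qed

lemma
  assumes "f \<in> E_functions" "g \<in> E_functions"
  shows eval_E_mult: "eval_fps (f * g) z = eval_fps f z * eval_fps g z"
    and eval_E_add: "eval_fps (f + g) z = eval_fps f z + eval_fps g z"
  using assms by (simp_all add: eval_fps_mult eval_fps_add fps_conv_radius_E_functions)

lemma eval_E_prod_list:
  assumes "\<And>f. f \<in> set fs \<Longrightarrow> f \<in> E_functions"
  shows "eval_fps (prod_list fs) z = (\<Prod>f\<leftarrow>fs. eval_fps f z)"
  using assms by (induction fs) (auto simp: eval_E_mult E_functions_prod_list)

section \<open>Zeros of E-functions\<close>

lemma E_dvd_trans: "E_dvd f g \<Longrightarrow> E_dvd g h \<Longrightarrow> E_dvd f h"
  unfolding E_dvd_def by (metis E_functions_mult mult.assoc)

lemma E_dvd_0: "E_dvd f 0"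
  unfolding E_dvd_def using E_functions_const[of 0] by auto

lemma E_dvd_unit_mult: "E_unit u \<Longrightarrow> E_dvd f (u * f)"
  unfolding E_dvd_def E_unit_def by (metis mult.commute)

lemma E_unit_nonvanishing: "E_unit u \<Longrightarrow> eval_fps u z \<noteq> 0"
  unfolding E_unit_def by (metis eval_E_mult eval_fps_1 mult_zero_left zero_neq_one)

lemma eval_E_sum:
  "(\<And>i. i \<in> A \<Longrightarrow> f i \<in> E_functions) \<Longrightarrow> eval_fps (sum f A) z = (\<Sum>i\<in>A. eval_fps (f i) z)"
  by (induction A rule: infinite_finite_induct) (auto simp: eval_E_add E_functions_sum)

lemma E_dvd_prod_list:
  assumes "\<And>f. f \<in> set fs \<Longrightarrow> f \<in> E_functions" "g \<in> set fs"
  shows "E_dvd g (prod_list fs)"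
proof -
  obtain xs ys where fs: "fs = xs @ g # ys" using assms(2) by (meson split_list)
  then have "prod_list fs = g * prod_list (xs @ ys)" by (simp add: mult_ac)
  moreover have "prod_list (xs @ ys) \<in> E_functions"
    using assms(1) fs by (intro E_functions_prod_list) auto
  ultimately show ?thesis unfolding E_dvd_def by blast
qed

text \<open>Evaluating the factorization at \<xi>: the unit does not vanish, hence one of the simple
  or irreducible factors does.\<close>

lemma vanishing_factor:
  assumes F: "Conjecture_F" and f: "f \<in> E_functions" "f \<noteq> 0" "eval_fps f \<xi> = 0"
  shows "(\<exists>s\<in>E_functions. E_simple s \<and> eval_fps s \<xi> = 0 \<and> E_dvd s f) \<or>
    (\<exists>h. E_irreducible h \<and> eval_fps h \<xi> = 0 \<and> E_dvd h f)"
proof -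
  obtain u ss hs where fact: "normalized_factorization f u ss hs"
    using F f unfolding Conjecture_F_def by blast
  define gs where "gs = ss @ hs"
  have u: "E_unit u" and f_eq: "f = u * prod_list gs"
    using fact by (auto simp: normalized_factorization_def gs_def mult.assoc)
  have E: "g \<in> E_functions" if "g \<in> set gs" for g
    using fact that by (auto simp: normalized_factorization_def gs_def E_normalized_def)
  have "eval_fps (prod_list gs) \<xi> = 0"
    using f(3) E_unit_nonvanishing[OF u] E_functions_prod_list[of gs] E u
    unfolding f_eq by (simp add: eval_E_mult E_unit_def)
  then have "0 \<in> set (map (\<lambda>g. eval_fps g \<xi>) gs)"
    using eval_E_prod_list[of gs \<xi>] E unfolding prod_list_zero_iff[symmetric] by simp
  then obtain g where g: "g \<in> set gs" "eval_fps g \<xi> = 0" by auto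
  have "E_dvd g f"
    unfolding f_eq by (rule E_dvd_trans[OF E_dvd_prod_list[OF E g(1)] E_dvd_unit_mult[OF u]])
  moreover have "E_simple g \<or> E_irreducible g"
    using fact g by (auto simp: normalized_factorization_def gs_def)
  ultimately show ?thesis using g E by blast
qed

section \<open>Exponential sums: simple functions with the power of \<open>fps_X\<close> moved to
  the other side\<close>

locale exponential_sum =
  fixes g :: "complex fps" and k :: nat and \<alpha> \<delta> :: complex and N :: nat
    and c :: "nat \<Rightarrow> complex" and q :: "nat \<Rightarrow> rat"
  assumes g: "g \<in> E_functions" and \<alpha>: "\<alpha> \<in> Qbar" and \<delta>: "\<delta> \<in> Qbar" "\<delta> \<noteq> 0" and N: "N > 0"
    and c: "\<And>i. i < N \<Longrightarrow> c i \<in> Qbar" "\<And>i. i < N \<Longrightarrow> c i \<noteq> 0" and q: "inj_on q {..<N}"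
    and expansion: "fps_X ^ k * g = fps_exp \<alpha> * (\<Sum>i<N. fps_const (c i) * fps_exp (\<delta> * of_rat (q i)))"
begin

text \<open>This rewrites simple functions with commensurable exponents in terms of one common
  generator.\<close>

lemma rescale:
  assumes "\<delta> = of_rat t * \<delta>'" "\<delta>' \<in> Qbar"
  shows "exponential_sum g k \<alpha> \<delta>' N c (\<lambda>i. t * q i)"
proof
  have "t \<noteq> 0" "\<delta>' \<noteq> 0" using assms \<delta> by auto
  then show "\<delta>' \<noteq> 0" "inj_on (\<lambda>i. t * q i) {..<N}"
    using q by (auto simp: inj_on_def)
  show "fps_X ^ k * g = fps_exp \<alpha> * (\<Sum>i<N. fps_const (c i) * fps_exp (\<delta>' * of_rat (t * q i)))"
    using expansion assms(1) by (simp add: of_rat_mult mult_ac)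
qed (use g \<alpha> N c assms in auto)

lemma term_in_E: "i < N \<Longrightarrow> fps_const (c i) * fps_exp (\<delta> * of_rat (q i)) \<in> E_functions"
  using c \<delta> rat_imp_algebraic[of "of_rat (q i)"] algebraic_mult
  by (intro E_functions_mult E_functions_const E_functions_exp) auto

lemma eval_expansion:
  "z ^ k * eval_fps g z = exp (\<alpha> * z) * (\<Sum>i<N. c i * exp (\<delta> * of_rat (q i) * z))"
proof -
  have E: "(\<Sum>i<N. fps_const (c i) * fps_exp (\<delta> * of_rat (q i))) \<in> E_functions"
    using term_in_E by (intro E_functions_sum) auto
  have "eval_fps (fps_X ^ k * g) z = z ^ k * eval_fps g z"
    by (subst eval_fps_mult) (simp_all add: fps_conv_radius_E_functions[OF g])
  moreover have "eval_fps (fps_exp \<alpha> * (\<Sum>i<N. fps_const (c i) * fps_exp (\<delta> * of_rat (q i)))) z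
      = exp (\<alpha> * z) * (\<Sum>i<N. eval_fps (fps_const (c i) * fps_exp (\<delta> * of_rat (q i))) z)"
    unfolding eval_E_mult[OF E_functions_exp[OF \<alpha>] E] using term_in_E
    by (subst eval_E_sum) auto
  moreover have "eval_fps (fps_const (c i) * fps_exp (\<delta> * of_rat (q i))) z
      = c i * exp (\<delta> * of_rat (q i) * z)" for i
    by (subst eval_fps_mult) simp_all
  ultimately show ?thesis using expansion by simp
qed

lemma common_denominator: "\<exists>M>0. \<forall>i<N. of_nat M * q i \<in> \<int>"
proof -
  have "\<exists>M>0. \<forall>i<n. of_nat M * q i \<in> \<int>" for n
  proof (induction n)
    case (Suc n)
    then obtain M where M: "M > 0" "\<forall>i<n. of_nat M * q i \<in> \<int>" by blast
    obtain a b where ab: "quotient_of (q n) = (a, b)" by (cases "quotient_of (q n)")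
    have b: "b > 0" "q n = of_int a / of_int b"
      using quotient_of_denom_pos[OF ab] quotient_of_div[OF ab] by auto
    have "of_nat (M * nat b) * q i \<in> \<int>" if "i < Suc n" for i
    proof (cases "i = n")
      case True
      have "of_nat (M * nat b) * q n = of_nat M * of_int a" using b by simp
      moreover have "rat_of_nat M * rat_of_int a \<in> \<int>" by (intro Ints_mult) auto
      ultimately show ?thesis using True by (simp only:)
    next
      case False
      then have "of_nat M * q i \<in> \<int>" using M that by auto
      from Ints_mult[OF Ints_of_nat this, of "nat b"] show ?thesis by (simp add: mult_ac)
    qed
    moreover have "M * nat b > 0" using M b by simp
    ultimately show ?case by blast
  qed auto
  then show ?thesis .
qed

lemma integer_exponents:
  assumes "M > 0" "\<And>i. i < N \<Longrightarrow> of_nat M * q i \<in> \<int>"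
  obtains n :: "nat \<Rightarrow> nat" and L :: nat where
    "\<And>i. i < N \<Longrightarrow> of_rat (q i) = (of_nat (n i) - of_nat L) / (of_nat M :: complex)"
    "inj_on n {..<N}"
proof
  define m where "m = (\<lambda>i. \<lfloor>of_nat M * q i\<rfloor>)"
  \<comment> \<open>The sum of all absolute values dominates each \<open>m i\<close>, so the shift
    by \<open>L\<close> makes every exponent a natural number.\<close>
  define L where "L = nat (\<Sum>i<N. \<bar>m i\<bar>)"
  define n where "n = (\<lambda>i. nat (m i + int L))"
  have q_eq: "q i = (of_nat (n i) - of_nat L) / of_nat M" if "i < N" for i
  proof -
    have "\<bar>m i\<bar> \<le> (\<Sum>i<N. \<bar>m i\<bar>)" using that by (intro member_le_sum) auto
    then have "m i + int L \<ge> 0" by (simp add: L_def)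
    then have "rat_of_nat (n i) = of_int (m i) + of_nat L"
      by (simp add: n_def)
    moreover have "of_int (m i) = of_nat M * q i"
      unfolding m_def by (rule of_int_floor) (use assms(2)[OF that] in simp)
    ultimately show ?thesis using assms(1) by simp
  qed
  show "of_rat (q i) = (of_nat (n i) - of_nat L) / (of_nat M :: complex)" if "i < N" for i
    unfolding q_eq[OF that] by (simp add: of_rat_divide of_rat_diff)
  show "inj_on n {..<N}"
    using q q_eq by (auto simp: inj_on_def)
qed

context
  fixes M :: nat and \<xi> :: complex
  assumes M: "M > 0" "\<And>i. i < N \<Longrightarrow> of_nat M * q i \<in> \<int>" and zero: "eval_fps g \<xi> = 0"
begin

lemma exponential_sum_zero: "(\<Sum>i<N. c i * exp (\<delta> * of_rat (q i) * \<xi>)) = 0"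
  using eval_expansion[of \<xi>] zero by simp

text \<open>All exponents are integer multiples of \<delta>/M, so the exponential sum has period 2
  pi i M/\<delta>. At \<open>z \<noteq> 0\<close> the factor z^k cancels.\<close>

lemma periodic_zero:
  assumes z: "z = \<xi> + of_int j * (2 * pi * \<i> * of_nat M / \<delta>)" "z \<noteq> 0"
  shows "eval_fps g z = 0"
proof -
  obtain n L where n: "\<And>i. i < N \<Longrightarrow> of_rat (q i) = (of_nat (n i) - of_nat L) / (of_nat M :: complex)"
    using integer_exponents[OF M] by metis
  have "exp (\<delta> * of_rat (q i) * z) = exp (\<delta> * of_rat (q i) * \<xi>)" if "i < N" for i
  proof -
    have "\<delta> * of_rat (q i) * z = \<delta> * of_rat (q i) * \<xi> + of_int (2 * (j * (int (n i) - int L))) * pi * \<i>"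
      using M(1) \<delta>(2) by (simp add: z n[OF that] field_simps)
    then show ?thesis by (subst exp_eq) blast
  qed
  then have "z ^ k * eval_fps g z = 0"
    using exponential_sum_zero by (simp add: eval_expansion)
  then show ?thesis using z(2) by simp
qed

text \<open>Multiplying the vanishing sum by the \<open>L\<close>-th power of exp(\<delta>\<xi>/M)
  removes the negative exponents.\<close>

lemma exponential_polynomial_zero:
  assumes n: "\<And>i. i < N \<Longrightarrow> of_rat (q i) = (of_nat (n i) - of_nat L) / (of_nat M :: complex)"
  shows "(\<Sum>i<N. c i * exp (\<delta> * \<xi> / of_nat M) ^ n i) = 0"
proof -
  have "(\<Sum>i<N. c i * exp (\<delta> * \<xi> / of_nat M) ^ n i)
      = exp (of_nat L * (\<delta> * \<xi> / of_nat M)) * (\<Sum>i<N. c i * exp (\<delta> * of_rat (q i) * \<xi>))"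
    unfolding sum_distrib_left
  proof (rule sum.cong)
    fix i assume "i \<in> {..<N}"
    then have "of_nat (n i) * (\<delta> * \<xi> / of_nat M)
        = of_nat L * (\<delta> * \<xi> / of_nat M) + \<delta> * of_rat (q i) * \<xi>"
      using M(1) by (simp add: n field_simps)
    then show "c i * exp (\<delta> * \<xi> / of_nat M) ^ n i
        = exp (of_nat L * (\<delta> * \<xi> / of_nat M)) * (c i * exp (\<delta> * of_rat (q i) * \<xi>))"
      by (simp add: exp_add flip: exp_of_nat_mult)
  qed simp
  then show ?thesis using exponential_sum_zero by simp
qed

lemma exp_zero_algebraic: "exp (\<delta> * \<xi> / of_nat M) \<in> Qbar"
proof -
  obtain n L where n: "\<And>i. i < N \<Longrightarrow> of_rat (q i) = (of_nat (n i) - of_nat L) / (of_nat M :: complex)"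
    "inj_on n {..<N}"
    using integer_exponents[OF M] by metis
  define P where "P = (\<Sum>i<N. Polynomial.monom (c i) (n i))"
  \<comment> \<open>The exponents are distinct, so this coefficient is exactly \<open>c 0\<close>,
    and \<open>P\<close> is non-zero.\<close>
  have "poly.coeff P (n 0) = (\<Sum>i<N. if i = 0 then c i else 0)"
    unfolding P_def coeff_sum
  proof (rule sum.cong)
    fix i assume "i \<in> {..<N}"
    then have "n i = n 0 \<longleftrightarrow> i = 0" using n(2) N by (auto simp: inj_on_def)
    then show "poly.coeff (Polynomial.monom (c i) (n i)) (n 0) = (if i = 0 then c i else 0)"
      by auto
  qed simp
  also have "\<dots> = c 0" using N by (simp add: sum.delta)
  finally have "P \<noteq> 0" using c(2)[OF N] by auto
  moreover have "poly P (exp (\<delta> * \<xi> / of_nat M)) = 0"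
    unfolding P_def poly_sum poly_monom by (rule exponential_polynomial_zero[OF n(1)])
  moreover have "poly.coeff P j \<in> Qbar" for j
    unfolding P_def coeff_sum using c(1) by (intro Qbar.sum_closed) auto
  ultimately show ?thesis using algebraic_if_root[of P] by simp
qed

lemma divisible_by_simple_exponential:
  assumes e: "exp (\<delta> * \<xi> / of_nat M) \<noteq> 1"
  shows "E_dvd (fps_exp (\<delta> / of_nat M) - fps_const (exp (\<delta> * \<xi> / of_nat M))) g"
proof -
  obtain n L where n: "\<And>i. i < N \<Longrightarrow> of_rat (q i) = (of_nat (n i) - of_nat L) / (of_nat M :: complex)"
    using integer_exponents[OF M] by metis
  define e where "e = exp (\<delta> * \<xi> / of_nat M)"
  define y where "y = fps_exp (\<delta> / of_nat M)"
  \<comment> \<open>This compensates for the shift by \<open>L\<close> that made the exponents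
    \<open>n i\<close> non-negative.\<close>
  define \<alpha>' where "\<alpha>' = \<alpha> - of_nat L * (\<delta> / of_nat M)"
  have \<delta>M: "\<delta> / of_nat M \<in> Qbar" using \<delta> algebraic_divide by auto
  then have \<alpha>': "\<alpha>' \<in> Qbar"
    unfolding \<alpha>'_def by (intro Qbar.diff_closed Qbar.mult_closed Qbar.of_nat_closed \<alpha>)
  have y: "y \<in> E_functions" unfolding y_def by (rule E_functions_exp[OF \<delta>M])
  have eQ: "e \<in> Qbar" unfolding e_def by (rule exp_zero_algebraic)
  \<comment> \<open>With P(Y) the sum of the terms c_i Y^(n_i), this is the cofactor of y - e in
    P(y) - P(e), and P(e) = 0.\<close>
  define H where "H = (\<Sum>i<N. fps_const (c i) * (\<Sum>j<n i. fps_const e ^ (n i - Suc j) * y ^ j))"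
  have H: "H \<in> E_functions"
    unfolding H_def using c(1)
    by (intro E_functions_sum E_functions_mult E_functions_const E_functions_power y eQ) auto
  have "fps_X ^ k * g = fps_exp \<alpha>' * (\<Sum>i<N. fps_const (c i) * y ^ n i)"
    unfolding expansion sum_distrib_left
  proof (rule sum.cong)
    fix i assume "i \<in> {..<N}"
    then have "\<alpha> + \<delta> * of_rat (q i) = \<alpha>' + of_nat (n i) * (\<delta> / of_nat M)"
      using M(1) by (simp add: n \<alpha>'_def field_simps)
    then have "fps_exp \<alpha> * fps_exp (\<delta> * of_rat (q i)) = fps_exp \<alpha>' * y ^ n i"
      by (simp add: y_def fps_exp_power_mult flip: fps_exp_add_mult)
    then show "fps_exp \<alpha> * (fps_const (c i) * fps_exp (\<delta> * of_rat (q i)))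
        = fps_exp \<alpha>' * (fps_const (c i) * y ^ n i)"
      by (metis mult.left_commute)
  qed simp
  also have "(\<Sum>i<N. fps_const (c i) * y ^ n i)
      = (\<Sum>i<N. fps_const (c i) * (y ^ n i - fps_const e ^ n i)) + fps_const (\<Sum>i<N. c i * e ^ n i)"
  proof -
    have "fps_const (\<Sum>i<N. c i * e ^ n i) = (\<Sum>i<N. fps_const (c i) * fps_const e ^ n i)"
      by (rule fps_ext) (simp add: fps_sum_nth fps_const_power)
    then show ?thesis by (simp add: right_diff_distrib sum_subtractf)
  qed
  also have "(\<Sum>i<N. c i * e ^ n i) = 0"
    unfolding e_def by (rule exponential_polynomial_zero[OF n])
  also have "(\<Sum>i<N. fps_const (c i) * (y ^ n i - fps_const e ^ n i)) = (y - fps_const e) * H"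
    unfolding H_def sum_distrib_left power_diff_sumr2 by (intro sum.cong) (auto simp: mult_ac)
  finally have *: "fps_X ^ k * g = (y - fps_const e) * (fps_exp \<alpha>' * H)"
    by (simp add: mult_ac)
  \<comment> \<open>The constant term of y - e is 1 - e, which is non-zero, so y - e is invertible
    among formal power series and X^k must divide the remaining factor.\<close>
  define G where "G = inverse (y - fps_const e) * g"
  have inv: "inverse (y - fps_const e) * (y - fps_const e) = 1"
    using e by (intro inverse_mult_eq_1) (simp add: y_def e_def)
  have "fps_X ^ k * G = inverse (y - fps_const e) * (fps_X ^ k * g)" by (simp add: G_def mult_ac)
  also have "\<dots> = fps_exp \<alpha>' * H" unfolding * mult.assoc[symmetric] inv by simp
  also have "\<dots> \<in> E_functions" using H \<alpha>' by (intro E_functions_mult E_functions_exp)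
  finally have "G \<in> E_functions" by (rule E_functions_divide_X_power)
  moreover have "g = (y - fps_const e) * G"
    unfolding G_def mult.assoc[symmetric] using inv by (simp add: mult.commute)
  ultimately show ?thesis unfolding E_dvd_def y_def e_def by blast
qed

end

end

text \<open>A negative \<omega> would make \<open>g\<close> divisible by \<open>fps_X\<close>,
  contrary to g(0) being non-zero; so the power of \<open>fps_X\<close> can be cleared by
  multiplication.\<close>

lemma simple_imp_exponential_sum:
  assumes "E_simple g" "g \<in> E_functions"
  obtains k \<alpha> \<delta> N c q where "exponential_sum g k \<alpha> \<delta> N c q" "fps_nth g 0 \<noteq> 0"
proof -
  obtain S where "simple_with_support g S" using assms(1) unfolding E_simple_def by blast
  then obtain \<omega> :: int and \<alpha> \<delta> N c q where *: "\<alpha> \<in> Qbar" "\<delta> \<in> Qbar" "\<delta> \<noteq> 0" "N \<ge> (2::nat)"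
    "\<forall>i<N. c i \<in> Qbar \<and> c i \<noteq> 0" "inj_on q {..<N}"
    "fps_to_fls g = fls_X_intpow (-\<omega>) *
       fps_to_fls (fps_exp \<alpha> * (\<Sum>i<N. fps_const (c i) * fps_exp (\<delta> * of_rat (q i))))"
    "fps_nth g 0 \<noteq> 0"
    unfolding simple_with_support_def by blast
  define F where "F = fps_exp \<alpha> * (\<Sum>i<N. fps_const (c i) * fps_exp (\<delta> * of_rat (q i)))"
  have X: "fls_X_intpow (int k) = fps_to_fls (fps_X ^ k :: complex fps)" for k
    by (simp add: fps_to_fls_power flip: fls_X_power_int)
  have "\<omega> \<ge> 0"
  proof (rule ccontr)
    assume "\<not> \<omega> \<ge> 0"
    then obtain k where k: "- \<omega> = int (Suc k)" by (metis add.inverse_inverse int_cases minus_less_iff neg_0_le_iff_le not_le zero_less_imp_eq_int gr0_implies_Suc)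
    have "fps_to_fls g = fps_to_fls (fps_X ^ Suc k * F)"
      using *(7) by (simp only: k X F_def fls_times_fps_to_fls)
    then have "g = fps_X ^ Suc k * F" by (simp only: fps_to_fls_eq_iff)
    then show False using *(8) by (simp add: mult.assoc)
  qed
  then obtain k where k: "\<omega> = int k" by (metis nonneg_int_cases)
  have "fps_to_fls (fps_X ^ k * g) = fls_X_intpow (int k) * fls_X_intpow (- int k) * fps_to_fls F"
    using *(7) by (simp only: fls_times_fps_to_fls X k F_def mult.assoc)
  also have "fls_X_intpow (int k) * fls_X_intpow (- int k) = (1 :: complex fls)"
    by (subst fls_X_intpow_times_fls_X_intpow) simp
  finally have "fps_X ^ k * g = F" by simp
  then have "exponential_sum g k \<alpha> \<delta> N c q"
    using * assms(2) by unfold_locales (auto simp: F_def)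
  then show ?thesis using that *(8) by blast
qed

text \<open>
  If two independent exponentials were algebraic at \<open>\<xi>\<close>, their generic linear combination vanishing
  at \<open>\<xi>\<close> would have a simple factor, hence vanish along an arithmetic progression through \<open>\<xi>\<close>.
  This avoids the theorem of Gelfond and Schneider.
\<close>
lemma commensurable_exponents:
  assumes F: "Conjecture_F" and Z: "Conjecture_Z" and "\<xi> \<noteq> 0"
    and \<beta>: "\<beta> \<in> Qbar" "\<beta> \<noteq> 0" "exp (\<beta> * \<xi>) \<in> Qbar"
    and \<beta>': "\<beta>' \<in> Qbar" "\<beta>' \<noteq> 0" "exp (\<beta>' * \<xi>) \<in> Qbar"
  obtains t :: rat where "\<beta>' = of_rat t * \<beta>"
proof (cases "\<beta> = \<beta>'")
  case True
  then show ?thesis by (intro that[of 1]) simp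
next
  case False
  define b where "b = exp (\<beta> * \<xi>)"
  define b' where "b' = exp (\<beta>' * \<xi>)"
  have b: "b \<noteq> 0" "b' \<noteq> 0" "b \<in> Qbar" "b' \<in> Qbar" using \<beta> \<beta>' by (auto simp: b_def b'_def)
  \<comment> \<open>One of t = 1 and t = 2 works. The last inequality settles the case
    \<open>A = B\<close> at the end.\<close>
  obtain t :: complex where t: "t \<in> Qbar" "t \<noteq> 0" "b + t * b' \<noteq> 0"
  proof (cases "b + b' = 0")
    case True
    then have "b + 2 * b' \<noteq> 0" using b by (metis add.assoc add_cancel_left_right mult_2)
    then show ?thesis by (intro that[of 2]) auto
  next
    case False
    then show ?thesis by (intro that[of 1]) auto
  qed
  define f where "f = fps_exp \<beta> + fps_const t * fps_exp \<beta>' + fps_const (- (b + t * b'))"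
  have E1: "fps_exp \<beta> \<in> E_functions" "fps_const t * fps_exp \<beta>' \<in> E_functions"
    "fps_const (- (b + t * b')) \<in> E_functions"
    by (intro E_functions_exp E_functions_mult E_functions_const t \<beta> \<beta>' b
          Qbar.uminus_closed Qbar.add_closed Qbar.mult_closed)+
  have f: "f \<in> E_functions" unfolding f_def by (intro E_functions_add E1)
  have eval: "eval_fps f z = exp (\<beta> * z) + t * exp (\<beta>' * z) - (b + t * b')" for z
  proof -
    have "eval_fps (fps_const t * fps_exp \<beta>') z = t * exp (\<beta>' * z)"
      by (subst eval_fps_mult) simp_all
    then show ?thesis
      unfolding f_def eval_E_add[OF E_functions_add[OF E1(1,2)] E1(3)] eval_E_add[OF E1(1,2)]
      by (simp del: fps_const_neg minus_add_distrib)
  qed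
  have "f \<noteq> 0"
  proof
    assume "f = 0"
    \<comment> \<open>The coefficients of degrees 1 and 2 form a linear system that has no solution
      with distinct non-zero exponents and t non-zero.\<close>
    then have "fps_nth f 1 = 0" "fps_nth f 2 = 0" by auto
    then have "\<beta> + t * \<beta>' = 0" "\<beta> ^ 2 + t * \<beta>' ^ 2 = 0"
      by (simp_all add: f_def fact_2 add_divide_distrib[symmetric])
    then have "t * \<beta>' * (\<beta>' - \<beta>) = 0"
      by (simp add: eq_neg_iff_add_eq_0[symmetric] power2_eq_square algebra_simps)
    then show False using t(2) \<beta>'(2) False by auto
  qed
  moreover have "eval_fps f \<xi> = 0" by (simp add: eval b_def b'_def)
  moreover have "eval_fps h \<xi> \<noteq> 0" if "E_irreducible h" for h
    using Z \<open>\<xi> \<noteq> 0\<close> \<beta> that unfolding Conjecture_Z_def by blast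
  ultimately obtain s where s: "s \<in> E_functions" "E_simple s" "eval_fps s \<xi> = 0" "E_dvd s f"
    using vanishing_factor[OF F f] by blast
  then obtain k \<alpha> \<delta> N c q where "exponential_sum s k \<alpha> \<delta> N c q"
    using simple_imp_exponential_sum by metis
  then interpret exponential_sum s k \<alpha> \<delta> N c q .
  obtain M where M: "M > 0" "\<And>i. i < N \<Longrightarrow> of_nat M * q i \<in> \<int>"
    using common_denominator by blast
  define \<tau> where "\<tau> = 2 * pi * \<i> * of_nat M / \<delta>"
  have \<tau>: "\<tau> \<noteq> 0" using M(1) \<delta>(2) by (simp add: \<tau>_def)
  have f_zero: "eval_fps f (\<xi> + of_int j * \<tau>) = 0" if "\<xi> + of_int j * \<tau> \<noteq> 0" for j
  proof -
    have "eval_fps s (\<xi> + of_int j * \<tau>) = 0"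
      using that by (intro periodic_zero[OF M s(3), of _ j]) (simp_all add: \<tau>_def)
    then show ?thesis using s(1,4) by (auto simp: E_dvd_def eval_E_mult)
  qed
  \<comment> \<open>Two further zeros are wanted, and \<open>periodic_zero\<close> speaks only of
    non-zero points. The progression meets 0 at most once, so one of the two directions avoids
    it.\<close>
  obtain l :: int where l: "l = 1 \<or> l = -1" "\<xi> + of_int l * \<tau> \<noteq> 0" "\<xi> + of_int (2 * l) * \<tau> \<noteq> 0"
  proof (cases "\<xi> + \<tau> = 0 \<or> \<xi> + 2 * \<tau> = 0")
    case True
    then have "\<xi> = - \<tau> \<or> \<xi> = - 2 * \<tau>" by (auto simp: eq_neg_iff_add_eq_0)
    then have "\<xi> - \<tau> = - 2 * \<tau> \<or> \<xi> - \<tau> = - 3 * \<tau>" "\<xi> - 2 * \<tau> = - 3 * \<tau> \<or> \<xi> - 2 * \<tau> = - 4 * \<tau>"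
      by auto
    then have "\<xi> - \<tau> \<noteq> 0" "\<xi> - 2 * \<tau> \<noteq> 0" using \<tau> by auto
    then show ?thesis by (intro that[of "-1"]) auto
  next
    case False
    then show ?thesis by (intro that[of 1]) auto
  qed
  define A where "A = exp (\<beta> * (of_int l * \<tau>))"
  define B where "B = exp (\<beta>' * (of_int l * \<tau>))"
  have A2: "exp (\<beta> * (\<xi> + of_int (2 * l) * \<tau>)) = b * A ^ 2"
    "exp (\<beta>' * (\<xi> + of_int (2 * l) * \<tau>)) = b' * B ^ 2"
    by (simp_all add: A_def B_def b_def b'_def algebra_simps flip: exp_add exp_of_nat_mult)
  have A1: "exp (\<beta> * (\<xi> + of_int l * \<tau>)) = b * A" "exp (\<beta>' * (\<xi> + of_int l * \<tau>)) = b' * B"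
    by (simp_all add: A_def B_def b_def b'_def algebra_simps flip: exp_add)
  have eqs: "b * A + t * (b' * B) = b + t * b'" "b * A ^ 2 + t * (b' * B ^ 2) = b + t * b'"
    using f_zero[OF l(2)] f_zero[OF l(3)] unfolding eval A1 A2 by auto
  \<comment> \<open>This combination of the two equations cancels every term containing t *
    b'.\<close>
  have "b * (A - 1) * (A - B)
      = (b * A ^ 2 + t * (b' * B ^ 2) - (b + t * b')) - (B + 1) * (b * A + t * (b' * B) - (b + t * b'))"
    by (simp add: algebra_simps power2_eq_square)
  then have "b * (A - 1) * (A - B) = 0" by (simp only: eqs) simp
  then have "A = 1 \<or> A = B" using b by auto
  then have AB: "A = 1 \<and> B = 1"
  proof
    assume "A = 1"
    then have "t * b' * (B - 1) = 0" using eqs(1) by (simp add: algebra_simps)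
    then show ?thesis using \<open>A = 1\<close> t b by auto
  next
    assume "A = B"
    then have "(b + t * b') * (A - 1) = 0" using eqs(1) by (simp add: algebra_simps)
    then show ?thesis using \<open>A = B\<close> t by auto
  qed
  \<comment> \<open>The argument is an integer multiple of 2 pi i; dividing out the definition of
    \<tau> leaves a relation with \<delta>. Applied to both exponents, it makes them rational
    multiples of \<delta>.\<close>
  have integral: "\<exists>n::int. x * of_int l * of_nat M = of_int n * \<delta>" if one: "exp (x * (of_int l * \<tau>)) = 1" for x
  proof -
    obtain n :: int where "x * (of_int l * \<tau>) = of_int (2 * n) * pi * \<i>"
      using one exp_eq[of "x * (of_int l * \<tau>)" 0] by auto
    then have "2 * pi * \<i> * (x * of_int l * of_nat M) = 2 * pi * \<i> * (of_int n * \<delta>)"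
      using \<delta>(2) by (simp add: \<tau>_def field_simps)
    then show ?thesis by auto
  qed
  obtain n n' :: int where n: "\<beta> * of_int l * of_nat M = of_int n * \<delta>"
    and n': "\<beta>' * of_int l * of_nat M = of_int n' * \<delta>"
    using integral[of \<beta>] integral[of \<beta>'] AB unfolding A_def B_def by blast
  have "n \<noteq> 0" using n \<beta>(2) M(1) l(1) by auto
  have "(\<beta>' * of_int n) * (of_int l * of_nat M) = of_int n * (of_int n' * \<delta>)"
    unfolding n'[symmetric] by (simp add: mult_ac)
  also have "\<dots> = of_int n' * (of_int n * \<delta>)" by simp
  also have "\<dots> = (of_int n' * \<beta>) * (of_int l * of_nat M)"
    unfolding n[symmetric] by (simp add: mult_ac)
  finally have "(\<beta>' * of_int n) * (of_int l * of_nat M) = (of_int n' * \<beta>) * (of_int l * of_nat M)" .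
  then have "\<beta>' * of_int n = of_int n' * \<beta>" using M(1) l(1) by auto
  then have "\<beta>' = of_rat (of_int n' / of_int n) * \<beta>"
    using \<open>n \<noteq> 0\<close> by (simp add: of_rat_divide field_simps)
  then show ?thesis by (rule that)
qed

text \<open>Inequality of the two truth values is the exclusive or. The proof splits on whether some
  irreducible E-function vanishes at \<xi>.\<close>

theorem theorem9:
  fixes \<xi> :: complex
  assumes "Conjecture_F" and "Conjecture_I" and "Conjecture_Z"
    and "\<exists>f\<in>E_functions. f \<noteq> 0 \<and> eval_fps f \<xi> = 0"
  shows "(\<xi> \<noteq> 0 \<and>
          (\<exists>\<beta>\<in>Qbar. \<beta> \<noteq> 0 \<and> exp (\<beta> * \<xi>) \<in> Qbar \<and>
             (\<forall>f\<in>E_functions. eval_fps f \<xi> = 0 \<longrightarrow>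
                (\<exists>N::nat. N \<ge> 1 \<and>
                   E_dvd (fps_exp (\<beta> / of_nat N) - fps_const (exp (\<beta> * \<xi> / of_nat N))) f))))
         \<noteq>
         (\<exists>h. E_irreducible h \<and> eval_fps h \<xi> = 0 \<and>
            (\<forall>f\<in>E_functions. eval_fps f \<xi> = 0 \<longrightarrow> E_dvd h f))"
  (is "?a \<noteq> ?b")
proof -
  have simple_zero: "\<xi> \<noteq> 0 \<and> (\<exists>k \<alpha> \<delta> N c q M. exponential_sum s k \<alpha> \<delta> N c q \<and> M > 0 \<and>
      (\<forall>i<N. of_nat M * q i \<in> \<int>) \<and> \<delta> / of_nat M \<in> Qbar \<and> \<delta> \<noteq> 0 \<and>
      exp (\<delta> / of_nat M * \<xi>) \<in> Qbar)"
    if s: "s \<in> E_functions" "E_simple s" "eval_fps s \<xi> = 0" for s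
  proof -
    obtain k \<alpha> \<delta> N c q where exp_sum: "exponential_sum s k \<alpha> \<delta> N c q" and "fps_nth s 0 \<noteq> 0"
      using simple_imp_exponential_sum s by metis
    \<comment> \<open>Simple functions do not vanish at 0.\<close>
    then have "\<xi> \<noteq> 0" using s(3) by (auto simp: eval_fps_at_0)
    interpret exponential_sum s k \<alpha> \<delta> N c q by (rule exp_sum)
    obtain M where M: "M > 0" "\<And>i. i < N \<Longrightarrow> of_nat M * q i \<in> \<int>"
      using common_denominator by blast
    have "exp (\<delta> / of_nat M * \<xi>) \<in> Qbar" using exp_zero_algebraic[OF M s(3)] by simp
    moreover have "\<delta> / of_nat M \<in> Qbar" using \<delta> algebraic_divide by auto
    ultimately show ?thesis using exp_sum M \<open>\<xi> \<noteq> 0\<close> \<delta>(2) by blast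
  qed
  have no_irreducible: "eval_fps h \<xi> \<noteq> 0"
    if "E_irreducible h" "\<xi> \<noteq> 0" "\<beta> \<in> Qbar" "\<beta> \<noteq> 0" "exp (\<beta> * \<xi>) \<in> Qbar" for h \<beta>
    using assms(3) that unfolding Conjecture_Z_def by blast
  show ?thesis
  proof (cases "\<exists>h. E_irreducible h \<and> eval_fps h \<xi> = 0")
    case True
    then obtain h where h: "E_irreducible h" "eval_fps h \<xi> = 0" by blast
    have "E_dvd h f" if f: "f \<in> E_functions" "eval_fps f \<xi> = 0" for f
    proof (cases "f = 0")
      case False
      have "\<not> (\<exists>s\<in>E_functions. E_simple s \<and> eval_fps s \<xi> = 0 \<and> E_dvd s f)"
      proof
        assume "\<exists>s\<in>E_functions. E_simple s \<and> eval_fps s \<xi> = 0 \<and> E_dvd s f"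
        then obtain s where "s \<in> E_functions" "E_simple s" "eval_fps s \<xi> = 0" by blast
        from simple_zero[OF this] obtain \<delta> and M :: nat where "\<xi> \<noteq> 0" "M > 0" "\<delta> / of_nat M \<in> Qbar"
          "\<delta> \<noteq> 0" "exp (\<delta> / of_nat M * \<xi>) \<in> Qbar" by blast
        then show False using no_irreducible[OF h(1), of "\<delta> / of_nat M"] h(2) by simp
      qed
      then obtain h' where h': "E_irreducible h'" "eval_fps h' \<xi> = 0" "E_dvd h' f"
        using vanishing_factor[OF assms(1) f(1) False f(2)] by blast
      then obtain u where "E_unit u" "h' = u * h"
        using assms(2) h unfolding Conjecture_I_def by blast
      then show ?thesis using E_dvd_unit_mult E_dvd_trans h'(3) by blast
    qed (simp add: E_dvd_0)
    then have ?b using h by blast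
    moreover have "\<not> ?a" using no_irreducible[OF h(1)] h(2) by blast
    ultimately show ?thesis by simp
  next
    case False
    have simple_factor: "\<exists>s\<in>E_functions. E_simple s \<and> eval_fps s \<xi> = 0 \<and> E_dvd s f"
      if "f \<in> E_functions" "f \<noteq> 0" "eval_fps f \<xi> = 0" for f
      using vanishing_factor[OF assms(1) that] False by blast
    obtain s\<^sub>0 where s\<^sub>0: "s\<^sub>0 \<in> E_functions" "E_simple s\<^sub>0" "eval_fps s\<^sub>0 \<xi> = 0"
      using assms(4) simple_factor by blast
    from simple_zero[OF this] obtain \<delta>\<^sub>0 and M\<^sub>0 :: nat where "\<xi> \<noteq> 0" and M\<^sub>0: "M\<^sub>0 > 0" "\<delta>\<^sub>0 / of_nat M\<^sub>0 \<in> Qbar"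
      "\<delta>\<^sub>0 \<noteq> 0" "exp (\<delta>\<^sub>0 / of_nat M\<^sub>0 * \<xi>) \<in> Qbar" by blast
    \<comment> \<open>The exponent is fixed by a single simple function, before \<open>f\<close>
      varies; \<open>commensurable_exponents\<close> later relates every other one to it.\<close>
    define \<beta> where "\<beta> = \<delta>\<^sub>0 / of_nat M\<^sub>0"
    have \<beta>: "\<beta> \<in> Qbar" "\<beta> \<noteq> 0" "exp (\<beta> * \<xi>) \<in> Qbar" using M\<^sub>0 by (auto simp: \<beta>_def)
    have "\<exists>K::nat. K \<ge> 1 \<and> E_dvd (fps_exp (\<beta> / of_nat K) - fps_const (exp (\<beta> * \<xi> / of_nat K))) f"
      if f: "f \<in> E_functions" "eval_fps f \<xi> = 0" for f
    proof (cases "f = 0")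
      case True
      then show ?thesis using E_dvd_0 by (intro exI[of _ 1]) auto
    next
      case f_nz: False
      obtain s where s: "s \<in> E_functions" "E_simple s" "eval_fps s \<xi> = 0" "E_dvd s f"
        using simple_factor[OF f(1) f_nz f(2)] by blast
      from simple_zero[OF s(1-3)] obtain k \<alpha> \<delta> N c q and M :: nat where
        exp_sum: "exponential_sum s k \<alpha> \<delta> N c q" and
        M: "M > 0" "\<delta> / of_nat M \<in> Qbar" "\<delta> \<noteq> 0" "exp (\<delta> / of_nat M * \<xi>) \<in> Qbar" by blast
      have "\<delta> / of_nat M \<noteq> 0" using M by simp
      then obtain t where "\<delta> / of_nat M = of_rat t * \<beta>"
        using commensurable_exponents[OF assms(1,3) \<open>\<xi> \<noteq> 0\<close> \<beta> M(2) _ M(4)] by blast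
      then have "\<delta> = of_rat (of_nat M * t) * \<beta>"
        using M(1) by (simp add: of_rat_mult field_simps)
      then interpret exponential_sum s k \<alpha> \<beta> N c "\<lambda>i. of_nat M * t * q i"
        by (rule exponential_sum.rescale[OF exp_sum _ \<beta>(1)])
      obtain M' where M': "M' > 0" "\<And>i. i < N \<Longrightarrow> of_nat M' * (of_nat M * t * q i) \<in> \<int>"
        using common_denominator by blast
      \<comment> \<open>Taking \<open>K\<close> to be a multiple of \<open>M'\<close> that is at
        least \<open>T\<close> keeps the exponents integral and makes the modulus of \<beta>\<xi>/K
        less than 1, below every non-zero multiple of 2 pi; hence the exponential differs from
        1.\<close>
      obtain T :: nat where T: "norm (\<beta> * \<xi>) < real T" using reals_Archimedean2 by blast
      then have "T > 0" using norm_ge_zero[of "\<beta> * \<xi>"] by (cases T) auto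
      define K where "K = T * M'"
      have K: "K > 0" using \<open>T > 0\<close> M'(1) by (simp add: K_def)
      have K_int: "of_nat K * (of_nat M * t * q i) \<in> \<int>" if "i < N" for i
        using Ints_mult[OF Ints_of_nat M'(2)[OF that], of T] by (simp add: K_def mult_ac)
      have "exp (\<beta> * \<xi> / of_nat K) \<noteq> 1"
      proof
        assume "exp (\<beta> * \<xi> / of_nat K) = 1"
        then obtain n :: int where n: "\<beta> * \<xi> / of_nat K = of_int (2 * n) * pi * \<i>"
          using exp_eq[of "\<beta> * \<xi> / of_nat K" 0] by auto
        have "n \<noteq> 0" using n \<open>\<xi> \<noteq> 0\<close> \<beta>(2) K by auto
        then have "1 \<le> \<bar>real_of_int n\<bar>" by linarith
        then have "1 * 1 \<le> \<bar>real_of_int (2 * n)\<bar> * pi" using pi_gt3 by (intro mult_mono) auto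
        also have "\<dots> = norm (\<beta> * \<xi> / of_nat K)" unfolding n by (simp add: norm_mult)
        also have "\<dots> < 1"
        proof -
          have "real T * 1 \<le> real T * real M'" using M'(1) by (intro mult_left_mono) auto
          then have "real T \<le> real K" by (simp add: K_def)
          then show ?thesis using T K by (simp add: norm_divide)
        qed
        finally show False by simp
      qed
      then have "E_dvd (fps_exp (\<beta> / of_nat K) - fps_const (exp (\<beta> * \<xi> / of_nat K))) s"
        using divisible_by_simple_exponential[of K \<xi>] K K_int s(3) by blast
      then show ?thesis using E_dvd_trans[OF _ s(4)] K by (intro exI[of _ K]) auto
    qed
    then have ?a using \<open>\<xi> \<noteq> 0\<close> \<beta> by blast
    moreover have "\<not> ?b" using False by blast
    ultimately show ?thesis by simp
  qed
qed

end
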